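(* Consider a distributed storage system with $n$ noncolluding servers storing $\mathsf M$ files, let $\eta$ be a positive integer with $\mathsf M/\eta\in\mathbb N$, and let $\tilde{\mathscr C}$ be an $(\mathsf M/\eta,n)$ IR scheme with achievable 4-tuple $(\tilde{\mathsf R},\tilde{\mathsf U},\tilde\Delta,\tilde\rho^{(\cdot)})$ (rate, upload cost, access complexity, leakage), where the superscript $(\cdot)$ indicates the leakage metric under consideration ($\mathsf{MI}$, $\mathsf{WIL}$, $\mathsf{MaxL}$, or $\epsilon\text{-}\mathsf P$). Then the 4-tuple $$\bigl(\mathsf R(\mathscr C),\mathsf U(\mathscr C),\Delta(\mathscr C),\rho^{(\cdot)}(\mathscr C)\bigr)=\bigl(\tilde{\mathsf R},\ \tilde{\mathsf U}+n\log_2\eta,\ \tilde\Delta,\ \tilde\rho^{(\cdot)}+\log_2\eta\bigr)$$ is achievable by the $(\mathsf M,n)$ partition scheme $\mathscr C$ constructed from $\tilde{\mathscr C}$.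
   Context: Notation: $[a]=\{1,\dots,a\}$; entropy $H$ and mutual information $I$ are in bits. There are $n$ noncolluding servers, each storing the same $\mathsf M$ independent files $X^{(1)},\dots,X^{(\mathsf M)}$, each uniformly distributed on $\mathcal X^\beta$. The requested file index $M$ is uniform on $[\mathsf M]$. An $(\mathsf M,n)$ IR (information retrieval) scheme $\mathscr C$ consists of: a random strategy $S$; queries $Q_l=\phi_l(M,S)\in\mathcal Q_l$ sent to server $l\in[n]$; answer-length functions $\ell_l:\mathcal Q_l\to\{0,1,\dots\}$; answers $A_l=\varphi_l(Q_l,X^{(1)},\dots,X^{(\mathsf M)})\in\mathcal A^{\ell_l(Q_l)}$; and access-number functions $\delta_l:\mathcal Q_l\to\{0,1,\dots\}$ (number of symbols accessed by the query); such that $H(X^{(M)}\mid A_1,\dots,A_n,Q_1,\dots,Q_n,M)=0$. The queries are independent of the files. Quantities: download cost $\mathsf D(\mathscr C)=\log_2|\mathcal A|\sum_{l=1}^n\mathbb E[\ell_l(Q_l)]$; rate $\mathsf R(\mathscr C)=\beta\log_2|\mathcal X|/\mathsf D(\mathscr C)$; upload cost $\mathsf U(\mathscr C)=\sum_{l=1}^n H(Q_l)$; access complexity $\Delta(\mathscr C)=\sum_{l=1}^n\mathbb E[\delta_l(Q_l)]$. A 4-tuple $(\mathsf R,\mathsf U,\Delta,\rho)$ is achievable with leakage metric $\rho^{(\cdot)}$ if there is an IR scheme with these values of rate, upload cost, access complexity and leakage. Leakage metrics: $\rho^{(\mathsf{MI})}(\mathscr C)=\frac1n\sum_{l\in[n]}I(M;Q_l)$;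 $\rho^{(\mathsf{WIL})}(\mathscr C)=\max_{l\in[n]}\bigl[H(M)-\min_{q\in\mathcal Q_l}H(M\mid Q_l=q)\bigr]$; $\rho^{(\mathsf{MaxL})}(\mathscr C)=\max_{l\in[n]}\log_2\sum_{q\in\mathcal Q_l}\max_{m\in[\mathsf M]}P_{Q_l|M}(q|m)$; $\rho^{(\epsilon\text{-}\mathsf P)}(\mathscr C)=\max_{l\in[n]}\ln\Bigl(\max_{q\in\mathcal Q_l}\max_{m,m'\in[\mathsf M]}\frac{P_{Q_l|M}(q|m)}{P_{Q_l|M}(q|m')}\Bigr)$. Partition scheme: the $\mathsf M$ files are divided into $\eta$ equally-sized partitions of $\mathsf M/\eta$ files each, and $\tilde{\mathscr C}$ is used to retrieve the file from its partition. If the requested file belongs to the $j$-th partition, $j\in[\eta]$, the query to server $l$ is $Q_l=(\tilde Q_l,j)\in\tilde{\mathcal Q}_l\times[\eta]$, where $\tilde Q_l\in\tilde{\mathcal Q}_l$ is the query of $\tilde{\mathscr C}$ (for the requested file among the $\mathsf M/\eta$ files of partition $j$), and the server answers as in $\tilde{\mathscr C}$ applied to the files of partition $j$.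
   Formalization: For the ε-P metric the claim is proved only when η = 1 or the leakage of the given scheme is infinite; for η ≥ 2 and finite leakage it is false, since a query naming its partition has probability 0 for files outside it, making the ε-P leakage infinite. *)

theory Defs
  imports "HOL-Probability.Probability"
begin

text \<open>
  Files, servers and partitions are numbered from 1.  The file alphabet and the answer alphabet
  are the finite types \<open>'x\<close> and \<open>'a\<close>; a file is a word of length \<open>\<beta>\<close>.
\<close>

definition file_space :: "nat \<Rightarrow> nat \<Rightarrow> (nat \<Rightarrow> 'x list) set" where
  "file_space N \<beta> = {1..N} \<rightarrow>\<^sub>E {w. length w = \<beta>}"

text \<open>
  In the fields below the first argument \<open>l\<close> is the server; \<open>queries l\<close> is the query alphabet of
  server \<open>l\<close> and \<open>strategy\<close> is the distribution of the random strategy.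
\<close>

record ('s, 'q, 'x, 'a) ir_scheme =
  strategy :: "'s measure"
  queries :: "nat \<Rightarrow> 'q set"
  query :: "nat \<Rightarrow> nat \<Rightarrow> 's \<Rightarrow> 'q"
  ans_len :: "nat \<Rightarrow> 'q \<Rightarrow> nat"
  answer :: "nat \<Rightarrow> 'q \<Rightarrow> (nat \<Rightarrow> 'x list) \<Rightarrow> 'a list"
  accesses :: "nat \<Rightarrow> 'q \<Rightarrow> nat"

text \<open>
  Outcomes are triples \<open>(m, s, X)\<close> of requested index, strategy and files, which are independent,
  with \<open>m\<close> and \<open>X\<close> uniform.
\<close>

definition ir_space ::
  "nat \<Rightarrow> nat \<Rightarrow> ('s, 'q, 'x::finite, 'a) ir_scheme \<Rightarrow> (nat \<times> 's \<times> (nat \<Rightarrow> 'x list)) measure" where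
  "ir_space N \<beta> C =
     uniform_count_measure {1..N} \<Otimes>\<^sub>M (strategy C \<Otimes>\<^sub>M uniform_count_measure (file_space N \<beta>))"

definition Mvar :: "nat \<times> 's \<times> (nat \<Rightarrow> 'x list) \<Rightarrow> nat" where
  "Mvar = (\<lambda>(m, s, X). m)"

definition Qvar ::
  "('s, 'q, 'x, 'a) ir_scheme \<Rightarrow> nat \<Rightarrow> nat \<times> 's \<times> (nat \<Rightarrow> 'x list) \<Rightarrow> 'q" where
  "Qvar C l = (\<lambda>(m, s, X). query C l m s)"

definition Avar ::
  "('s, 'q, 'x, 'a) ir_scheme \<Rightarrow> nat \<Rightarrow> nat \<times> 's \<times> (nat \<Rightarrow> 'x list) \<Rightarrow> 'a list" where
  "Avar C l = (\<lambda>(m, s, X). answer C l (query C l m s) X)"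

definition requested_file :: "nat \<times> 's \<times> (nat \<Rightarrow> 'x list) \<Rightarrow> 'x list" where
  "requested_file = (\<lambda>(m, s, X). X m)"

text \<open>
  For random variables with finite range these are the library's
  \<open>\<H>(X)\<close>, \<open>\<H>(X | Y)\<close> and \<open>\<I>(X ; Y)\<close> with base 2.
\<close>

abbreviation H2 :: "'w measure \<Rightarrow> ('w \<Rightarrow> 'b) \<Rightarrow> real" where
  "H2 P X \<equiv> prob_space.entropy P 2 (count_space (X ` space P)) X"

abbreviation H2_cond :: "'w measure \<Rightarrow> ('w \<Rightarrow> 'b) \<Rightarrow> ('w \<Rightarrow> 'c) \<Rightarrow> real" where
  "H2_cond P X Y \<equiv>
     prob_space.conditional_entropy P 2 (count_space (X ` space P)) (count_space (Y ` space P)) X Y"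

abbreviation I2 :: "'w measure \<Rightarrow> ('w \<Rightarrow> 'b) \<Rightarrow> ('w \<Rightarrow> 'c) \<Rightarrow> real" where
  "I2 P X Y \<equiv>
     prob_space.mutual_information P 2 (count_space (X ` space P)) (count_space (Y ` space P)) X Y"

text \<open>The entropy of \<open>X\<close> given the single event \<open>Y = y\<close>, which must have positive probability.\<close>

definition H2_event :: "'w measure \<Rightarrow> ('w \<Rightarrow> 'b) \<Rightarrow> ('w \<Rightarrow> 'c) \<Rightarrow> 'c \<Rightarrow> real" where
  "H2_event P X Y y = H2 (uniform_measure P {\<omega> \<in> space P. Y \<omega> = y}) X"

definition is_ir_scheme ::
  "nat \<Rightarrow> nat \<Rightarrow> nat \<Rightarrow> ('s, 'q, 'x::finite, 'a::finite) ir_scheme \<Rightarrow> bool" where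
  "is_ir_scheme N n \<beta> C \<longleftrightarrow>
     prob_space (strategy C) \<and>
     (\<forall>l\<in>{1..n}. finite (queries C l)) \<and>
     (\<forall>l\<in>{1..n}. \<forall>m\<in>{1..N}. query C l m \<in> strategy C \<rightarrow>\<^sub>M count_space (queries C l)) \<and>
     (\<forall>l\<in>{1..n}. \<forall>q\<in>queries C l. \<forall>X\<in>file_space N \<beta>. length (answer C l q X) = ans_len C l q) \<and>
     H2_cond (ir_space N \<beta> C) requested_file
       (\<lambda>\<omega>. (map (\<lambda>l. Avar C l \<omega>) [1..<Suc n], map (\<lambda>l. Qvar C l \<omega>) [1..<Suc n], Mvar \<omega>)) = 0"

definition download_cost ::
  "nat \<Rightarrow> nat \<Rightarrow> nat \<Rightarrow> ('s, 'q, 'x::finite, 'a::finite) ir_scheme \<Rightarrow> real" where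
  "download_cost N n \<beta> C =
     log 2 (real CARD('a)) * (\<Sum>l=1..n. \<integral>\<omega>. real (ans_len C l (Qvar C l \<omega>)) \<partial>ir_space N \<beta> C)"

definition rate ::
  "nat \<Rightarrow> nat \<Rightarrow> nat \<Rightarrow> ('s, 'q, 'x::finite, 'a::finite) ir_scheme \<Rightarrow> real" where
  "rate N n \<beta> C = real \<beta> * log 2 (real CARD('x)) / download_cost N n \<beta> C"

definition upload_cost ::
  "nat \<Rightarrow> nat \<Rightarrow> nat \<Rightarrow> ('s, 'q, 'x::finite, 'a) ir_scheme \<Rightarrow> real" where
  "upload_cost N n \<beta> C = (\<Sum>l=1..n. H2 (ir_space N \<beta> C) (Qvar C l))"

definition access_complexity ::
  "nat \<Rightarrow> nat \<Rightarrow> nat \<Rightarrow> ('s, 'q, 'x::finite, 'a) ir_scheme \<Rightarrow> real" where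
  "access_complexity N n \<beta> C =
     (\<Sum>l=1..n. \<integral>\<omega>. real (accesses C l (Qvar C l \<omega>)) \<partial>ir_space N \<beta> C)"

definition query_prob ::
  "nat \<Rightarrow> nat \<Rightarrow> ('s, 'q, 'x::finite, 'a) ir_scheme \<Rightarrow> nat \<Rightarrow> 'q \<Rightarrow> nat \<Rightarrow> real" where
  "query_prob N \<beta> C l q m = \<P>(\<omega> in ir_space N \<beta> C. Qvar C l \<omega> = q \<bar> Mvar \<omega> = m)"

definition leak_MI ::
  "nat \<Rightarrow> nat \<Rightarrow> nat \<Rightarrow> ('s, 'q, 'x::finite, 'a) ir_scheme \<Rightarrow> real" where
  "leak_MI N n \<beta> C = 1 / real n * (\<Sum>l\<in>{1..n}. I2 (ir_space N \<beta> C) Mvar (Qvar C l))"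

text \<open>The minimum is over the queries for which the conditional entropy is defined.\<close>

definition leak_WIL ::
  "nat \<Rightarrow> nat \<Rightarrow> nat \<Rightarrow> ('s, 'q, 'x::finite, 'a) ir_scheme \<Rightarrow> real" where
  "leak_WIL N n \<beta> C =
     (MAX l\<in>{1..n}. H2 (ir_space N \<beta> C) Mvar -
        (MIN q\<in>{q \<in> queries C l. \<P>(\<omega> in ir_space N \<beta> C. Qvar C l \<omega> = q) > 0}.
           H2_event (ir_space N \<beta> C) Mvar (Qvar C l) q))"

definition leak_MaxL ::
  "nat \<Rightarrow> nat \<Rightarrow> nat \<Rightarrow> ('s, 'q, 'x::finite, 'a) ir_scheme \<Rightarrow> real" where
  "leak_MaxL N n \<beta> C =
     (MAX l\<in>{1..n}. log 2 (\<Sum>q\<in>queries C l. MAX m\<in>{1..N}. query_prob N \<beta> C l q m))"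

definition ln_ereal :: "ereal \<Rightarrow> ereal" where
  "ln_ereal r = (if r = \<infinity> then \<infinity> else ereal (ln (real_of_ereal r)))"

text \<open>
  In \<^typ>\<open>ereal\<close> we have \<open>p / 0 = \<infinity>\<close> for \<open>p > 0\<close> and \<open>0 / 0 = 0\<close>.  The latter does not affect the
  maximum, which is at least 1 because of the terms with \<open>m = m'\<close>.
\<close>

definition leak_EpsP ::
  "nat \<Rightarrow> nat \<Rightarrow> nat \<Rightarrow> ('s, 'q, 'x::finite, 'a) ir_scheme \<Rightarrow> ereal" where
  "leak_EpsP N n \<beta> C =
     (MAX l\<in>{1..n}. ln_ereal (MAX q\<in>queries C l. MAX m\<in>{1..N}. MAX m'\<in>{1..N}.
        ereal (query_prob N \<beta> C l q m) / ereal (query_prob N \<beta> C l q m')))"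

datatype leak_metric = MI | WIL | MaxL | EpsP

fun leakage ::
  "leak_metric \<Rightarrow> nat \<Rightarrow> nat \<Rightarrow> nat \<Rightarrow> ('s, 'q, 'x::finite, 'a) ir_scheme \<Rightarrow> ereal" where
  "leakage MI N n \<beta> C = ereal (leak_MI N n \<beta> C)"
| "leakage WIL N n \<beta> C = ereal (leak_WIL N n \<beta> C)"
| "leakage MaxL N n \<beta> C = ereal (leak_MaxL N n \<beta> C)"
| "leakage EpsP N n \<beta> C = leak_EpsP N n \<beta> C"

definition achieves ::
  "leak_metric \<Rightarrow> nat \<Rightarrow> nat \<Rightarrow> nat \<Rightarrow> ('s, 'q, 'x::finite, 'a::finite) ir_scheme \<Rightarrow>
   real \<times> real \<times> real \<times> ereal \<Rightarrow> bool" where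
  "achieves lk N n \<beta> C t \<longleftrightarrow>
     is_ir_scheme N n \<beta> C \<and>
     t = (rate N n \<beta> C, upload_cost N n \<beta> C, access_complexity N n \<beta> C, leakage lk N n \<beta> C)"

text \<open>
  A division of files \<open>1..M\<close> into \<open>\<eta>\<close> partitions of \<open>M div \<eta>\<close> files each is given by a bijection
  \<open>pos\<close>: file \<open>m\<close> is the \<open>i\<close>-th file of partition \<open>j\<close> if \<open>pos m = (j, i)\<close>.
\<close>

definition equal_partition :: "nat \<Rightarrow> nat \<Rightarrow> (nat \<Rightarrow> nat \<times> nat) \<Rightarrow> bool" where
  "equal_partition M \<eta> pos \<longleftrightarrow> bij_betw pos {1..M} ({1..\<eta>} \<times> {1..M div \<eta>})"

definition partition_files ::
  "nat \<Rightarrow> nat \<Rightarrow> (nat \<Rightarrow> nat \<times> nat) \<Rightarrow> nat \<Rightarrow> (nat \<Rightarrow> 'x list) \<Rightarrow> nat \<Rightarrow> 'x list" where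
  "partition_files M \<eta> pos j X = (\<lambda>i\<in>{1..M div \<eta>}. X (inv_into {1..M} pos (j, i)))"

definition partition_scheme ::
  "nat \<Rightarrow> nat \<Rightarrow> (nat \<Rightarrow> nat \<times> nat) \<Rightarrow> ('s, 'q, 'x, 'a) ir_scheme \<Rightarrow> ('s, 'q \<times> nat, 'x, 'a) ir_scheme" where
  "partition_scheme M \<eta> pos C =
     \<lparr>strategy = strategy C,
      queries = (\<lambda>l. queries C l \<times> {1..\<eta>}),
      query = (\<lambda>l m s. (query C l (snd (pos m)) s, fst (pos m))),
      ans_len = (\<lambda>l (q, j). ans_len C l q),
      answer = (\<lambda>l (q, j) X. answer C l q (partition_files M \<eta> pos j X)),
      accesses = (\<lambda>l (q, j). accesses C l q)\<rparr>"

lemma finite_file_space: "finite (file_space N \<beta> :: (nat \<Rightarrow> 'x::finite list) set)"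
  using finite_lists_length_eq[of "UNIV :: 'x set" \<beta>]
  by (auto simp: file_space_def intro!: finite_PiE)

lemma file_space_nonempty: "(file_space N \<beta> :: (nat \<Rightarrow> 'x::finite list) set) \<noteq> {}"
proof -
  have "replicate \<beta> undefined \<in> {w :: 'x list. length w = \<beta>}" by simp
  then have "{w :: 'x list. length w = \<beta>} \<noteq> {}" by blast
  then show ?thesis by (auto simp: file_space_def PiE_eq_empty_iff)
qed

lemma query_prob_eq:
  fixes C :: "('s, 'q, 'x::finite, 'a) ir_scheme"
  assumes S: "prob_space (strategy C)" and m: "m \<in> {1..N}"
    and meas: "query C l m \<in> strategy C \<rightarrow>\<^sub>M count_space (queries C l)"
  shows "query_prob N \<beta> C l q m = measure (strategy C) {s \<in> space (strategy C). query C l m s = q}"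
proof -
  let ?U = "uniform_count_measure {1..N}" and ?F = "uniform_count_measure (file_space N \<beta> :: (nat \<Rightarrow> 'x list) set)"
  interpret S: prob_space "strategy C" by (rule S)
  interpret U: prob_space ?U using m by (intro prob_space_uniform_count_measure) auto
  interpret F: prob_space ?F
    by (intro prob_space_uniform_count_measure finite_file_space file_space_nonempty)
  interpret T: prob_space "strategy C \<Otimes>\<^sub>M ?F"
    by (rule prob_space_pair[OF S F.prob_space_axioms])
  have rect: "measure (ir_space N \<beta> C) ({m} \<times> (A \<times> space ?F)) = measure ?U {m} * measure (strategy C) A"
    if "A \<in> sets (strategy C)" for A
  proof -
    have "emeasure (ir_space N \<beta> C) ({m} \<times> (A \<times> space ?F)) =
        emeasure ?U {m} * emeasure (strategy C \<Otimes>\<^sub>M ?F) (A \<times> space ?F)"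
      unfolding ir_space_def using that m
      by (intro T.emeasure_pair_measure_Times) (auto simp: sets_uniform_count_measure)
    also have "emeasure (strategy C \<Otimes>\<^sub>M ?F) (A \<times> space ?F) = emeasure (strategy C) A"
      using that by (simp add: F.emeasure_pair_measure_Times F.emeasure_space_1)
    finally show ?thesis by (simp add: measure_def enn2real_mult)
  qed
  let ?A = "{s \<in> space (strategy C). query C l m s = q}"
  have A: "?A \<in> sets (strategy C)"
  proof -
    have "?A = query C l m -` ({q} \<inter> queries C l) \<inter> space (strategy C)"
      using measurable_space[OF meas] by auto
    also have "\<dots> \<in> sets (strategy C)" by (rule measurable_sets[OF meas]) auto
    finally show ?thesis .
  qed
  have "{\<omega> \<in> space (ir_space N \<beta> C). Qvar C l \<omega> = q \<and> Mvar \<omega> = m} = {m} \<times> (?A \<times> space ?F)"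
    using m by (auto simp: ir_space_def space_pair_measure Qvar_def Mvar_def space_uniform_count_measure)
  moreover have "{\<omega> \<in> space (ir_space N \<beta> C). Mvar \<omega> = m} = {m} \<times> (space (strategy C) \<times> space ?F)"
    using m by (auto simp: ir_space_def space_pair_measure Mvar_def space_uniform_count_measure)
  moreover have "measure ?U {m} \<noteq> 0"
    using m by (subst measure_uniform_count_measure) auto
  ultimately show ?thesis
    using rect[OF A] rect[OF sets.top] by (simp add: query_prob_def cond_prob_def S.prob_space)
qed

text \<open>
  With at least two partitions the \<open>\<epsilon>\<close>-privacy leakage of a partition scheme is infinite: a query
  naming partition \<open>j\<close> has probability 0 whenever the requested file lies outside partition \<open>j\<close>.
\<close>

lemma leak_EpsP_partition_scheme:
  fixes C :: "('s, 'q, 'x::finite, 'a::finite) ir_scheme"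
  assumes C: "is_ir_scheme (M div \<eta>) n \<beta> C" and pos: "equal_partition M \<eta> pos"
    and "1 \<le> n" "0 < M" "\<eta> dvd M" "2 \<le> \<eta>"
  shows "leak_EpsP M n \<beta> (partition_scheme M \<eta> pos C) = \<infinity>"
proof -
  let ?P = "partition_scheme M \<eta> pos C"
  have K: "1 \<le> M div \<eta>" using assms(4,5) by (auto elim!: dvdE)
  have S: "prob_space (strategy C)" using C by (simp add: is_ir_scheme_def)
  interpret S: prob_space "strategy C" by (rule S)
  have bij: "bij_betw pos {1..M} ({1..\<eta>} \<times> {1..M div \<eta>})"
    using pos by (simp add: equal_partition_def)
  have "(1, 1) \<in> pos ` {1..M}" "(2, 1) \<in> pos ` {1..M}"
    using bij_betw_imp_surj_on[OF bij] K assms(6) by simp_all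
  then obtain m m' where m: "m \<in> {1..M}" "pos m = (1, 1)" and m': "m' \<in> {1..M}" "pos m' = (2, 1)"
    by (metis imageE)
  have meas: "query C 1 1 \<in> strategy C \<rightarrow>\<^sub>M count_space (queries C 1)"
    and fin: "finite (queries C 1)"
    using C K assms(3) by (auto simp: is_ir_scheme_def)
  have measP: "query ?P 1 k \<in> strategy ?P \<rightarrow>\<^sub>M count_space (queries ?P 1)" if "k \<in> {1..M}" for k
  proof -
    have k: "pos k \<in> {1..\<eta>} \<times> {1..M div \<eta>}" using bij_betwE[OF bij] that by blast
    have "query C 1 (snd (pos k)) \<in> strategy C \<rightarrow>\<^sub>M count_space (queries C 1)"
      using C assms(3) k by (auto simp: is_ir_scheme_def)
    then have "(\<lambda>s. (query C 1 (snd (pos k)) s, fst (pos k)))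
        \<in> strategy C \<rightarrow>\<^sub>M count_space (queries C 1 \<times> {1..\<eta>})"
    proof (rule measurable_compose)
      show "(\<lambda>q. (q, fst (pos k))) \<in> count_space (queries C 1) \<rightarrow>\<^sub>M count_space (queries C 1 \<times> {1..\<eta>})"
        using k by (auto simp: measurable_count_space_eq1)
    qed
    then show ?thesis by (simp add: partition_scheme_def)
  qed
  have qp: "query_prob M \<beta> ?P 1 q k =
      measure (strategy C) {s \<in> space (strategy C). (query C 1 (snd (pos k)) s, fst (pos k)) = q}"
    if "k \<in> {1..M}" for q k
    using query_prob_eq[of ?P k M 1 \<beta> q] S that measP[OF that] by (simp add: partition_scheme_def)
  have "\<exists>q\<in>queries C 1. measure (strategy C) {s \<in> space (strategy C). query C 1 1 s = q} \<noteq> 0"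
  proof (rule ccontr)
    assume "\<not> ?thesis"
    then have z: "measure (strategy C) {s \<in> space (strategy C). query C 1 1 s = q} = 0"
      if "q \<in> queries C 1" for q using that by auto
    have sets: "{s \<in> space (strategy C). query C 1 1 s = q} \<in> sets (strategy C)"
      if "q \<in> queries C 1" for q
    proof -
      have "{s \<in> space (strategy C). query C 1 1 s = q} = query C 1 1 -` {q} \<inter> space (strategy C)"
        by auto
      then show ?thesis using measurable_sets[OF meas, of "{q}"] that by simp
    qed
    have "space (strategy C) = (\<Union>q\<in>queries C 1. {s \<in> space (strategy C). query C 1 1 s = q})"
      using measurable_space[OF meas] by auto
    then have "measure (strategy C) (space (strategy C)) =
        measure (strategy C) (\<Union>q\<in>queries C 1. {s \<in> space (strategy C). query C 1 1 s = q})"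
      by simp
    also have "\<dots> = (\<Sum>q\<in>queries C 1. measure (strategy C) {s \<in> space (strategy C). query C 1 1 s = q})"
      using sets by (intro S.finite_measure_finite_Union fin) (auto simp: disjoint_family_on_def)
    also have "\<dots> = 0" using z by simp
    finally show False using S.prob_space by simp
  qed
  then obtain q where q: "q \<in> queries C 1"
    "measure (strategy C) {s \<in> space (strategy C). query C 1 1 s = q} > 0"
    using zero_less_measure_iff by meson
  have "query_prob M \<beta> ?P 1 (q, 1) m > 0" "query_prob M \<beta> ?P 1 (q, 1) m' = 0"
    using q m m' by (simp_all add: qp del: One_nat_def)
  then have inf: "ereal (query_prob M \<beta> ?P 1 (q, 1) m) / ereal (query_prob M \<beta> ?P 1 (q, 1) m') = \<infinity>"
    by simp
  let ?r = "\<lambda>q m m'. ereal (query_prob M \<beta> ?P 1 q m) / ereal (query_prob M \<beta> ?P 1 q m')"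
  have q1: "(q, 1) \<in> queries ?P 1" and finP: "finite (queries ?P 1)"
    using q fin assms(6) by (auto simp: partition_scheme_def)
  have "?r (q, 1) m m' \<le> (MAX k'\<in>{1..M}. ?r (q, 1) m k')" using m' by (intro Max_ge) auto
  also have "\<dots> \<le> (MAX k\<in>{1..M}. MAX k'\<in>{1..M}. ?r (q, 1) k k')" using m by (intro Max_ge) auto
  also have "\<dots> \<le> (MAX q\<in>queries ?P 1. MAX k\<in>{1..M}. MAX k'\<in>{1..M}. ?r q k k')"
    using q1 finP by (intro Max_ge) auto
  finally have "ln_ereal (MAX q\<in>queries ?P 1. MAX k\<in>{1..M}. MAX k'\<in>{1..M}. ?r q k k') = \<infinity>"
    using inf by (simp add: ln_ereal_def)
  moreover have "ln_ereal (MAX q\<in>queries ?P 1. MAX k\<in>{1..M}. MAX k'\<in>{1..M}. ?r q k k')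
      \<le> leak_EpsP M n \<beta> ?P"
    unfolding leak_EpsP_def using assms(3) by (intro Max_ge) auto
  ultimately show ?thesis by simp
qed

end

theory Submission
  imports Defs
begin

text \<open>
  Map an outcome of the partition scheme to the partition \<open>J\<close> of the requested file together with
  the outcome of \<open>C\<close> on that partition (index within the partition, strategy, files of the
  partition).  Under this map \<open>J\<close> is uniform on \<open>{1..\<eta>}\<close> and independent of the second component,
  which has the law of \<open>C\<close>.  Every random variable of the partition scheme whose entropy matters
  determines, and is determined by, \<open>J\<close> and its counterpart in \<open>C\<close>, so its entropy grows by exactly
  \<open>log 2 \<eta>\<close>; conditional entropies, being differences of two such entropies, do not change.
\<close>

text \<open>Two facts give the law of \<open>(part, proj)\<close>. Since \<open>pos\<close> is a
  bijection, partition number and index within the partition are jointly uniform on a product set.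
  For each fixed \<open>j\<close>, the files of partition \<open>j\<close> are distinct coordinates
  of an independent uniform family, hence again independent and uniform, with a law that does not
  depend on \<open>j\<close>. All other files are forgotten: queries, answers and the requested file
  do not depend on them.

  Of the leakages only \<open>MI\<close> is a combination of plain entropies. \<open>WIL\<close>
  conditions on single query values, which fix the partition and leave the posterior inside it
  unchanged, so only the entropy of the request grows. \<open>MaxL\<close> is a count: each query
  gets \<eta> copies with the same maximal probability. \<open>EpsP\<close> is the obstacle: naming
  the partition makes some query probabilities vanish, so for at least two partitions the leakage is
  infinite and the formula fails for finite \<rho>. Hence the hypothesis \<open>eps\<close>.\<close>

section \<open>Entropies of simple functions as finite sums\<close>

text \<open>The alphabet \<open>A\<close> may exceed the range of \<open>X\<close>, because the
  joint entropies in the library live on products of ranges, which a pair of variables need not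
  fill.\<close>

lemma entropy_finite_range:
  assumes P: "prob_space P" and X: "simple_function P X" and A: "X ` space P \<subseteq> A" "finite A"
  shows "prob_space.entropy P 2 (count_space A) X =
    - (\<Sum>a\<in>A. measure P {\<omega> \<in> space P. X \<omega> = a} * log 2 (measure P {\<omega> \<in> space P. X \<omega> = a}))"
proof -
  interpret prob_space P by (rule P)
  interpret information_space P 2 by standard simp
  let ?p = "\<lambda>a. measure P {\<omega> \<in> space P. X \<omega> = a}"
  have "distributed P (count_space A) X
      (\<lambda>a. if a \<in> X ` space P then measure P (X -` {a} \<inter> space P) else 0)"
    using distributed_simple_function_superset[OF X _ A] by simp
  \<comment> \<open>The default density 0 off the range is the true probability there, since the
    event is empty.\<close>
  also have "(\<lambda>a. if a \<in> X ` space P then measure P (X -` {a} \<inter> space P) else 0) = ?p"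
  proof
    fix a
    have "X -` {a} \<inter> space P = {\<omega> \<in> space P. X \<omega> = a}" by auto
    moreover have "{\<omega> \<in> space P. X \<omega> = a} = {}" if "a \<notin> X ` space P" using that by auto
    ultimately show "(if a \<in> X ` space P then measure P (X -` {a} \<inter> space P) else 0) = ?p a"
      by (metis measure_empty)
  qed
  finally have "entropy 2 (count_space A) X = - (\<integral>a. ?p a * log 2 (?p a) \<partial>count_space A)"
    by (rule entropy_distr) simp
  then show ?thesis
    using A(2) by (simp add: lebesgue_integral_count_space_finite)
qed

text \<open>Values that are not attained contribute \<open>0 * log 2 0 = 0\<close>, so any finite
  superset of the range can serve as the index set.\<close>

lemma H2_finite_range:
  assumes P: "prob_space P" and X: "simple_function P X" and A: "X ` space P \<subseteq> A" "finite A"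
  shows "H2 P X =
    - (\<Sum>a\<in>A. measure P {\<omega> \<in> space P. X \<omega> = a} * log 2 (measure P {\<omega> \<in> space P. X \<omega> = a}))"
proof -
  have z: "{\<omega> \<in> space P. X \<omega> = a} = {}" if "a \<notin> X ` space P" for a
    using that by auto
  show ?thesis
    using entropy_finite_range[OF P X subset_refl simple_functionD(1)[OF X]] A
    by (auto simp: z intro!: sum.mono_neutral_left)
qed

text \<open>The library's chain rule takes the joint entropy on the product of the two ranges,
  \<open>H2\<close> on the range of the pair; both equal the same sum over the product.\<close>

lemma H2_cond_eq:
  assumes P: "prob_space P" and X: "simple_function P X" and Y: "simple_function P Y"
  shows "H2_cond P X Y = H2 P (\<lambda>\<omega>. (X \<omega>, Y \<omega>)) - H2 P Y"
proof -
  interpret prob_space P by (rule P)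
  interpret information_space P 2 by standard simp
  note fin = simple_functionD(1)[OF X] simple_functionD(1)[OF Y]
  have sub: "(\<lambda>\<omega>. (X \<omega>, Y \<omega>)) ` space P \<subseteq> X ` space P \<times> Y ` space P"
    "finite (X ` space P \<times> Y ` space P)" using fin by auto
  show ?thesis
    unfolding conditional_entropy_eq_entropy_simple[OF X Y]
    using fin
    by (simp add: pair_measure_count_space entropy_finite_range[OF P simple_function_Pair[OF X Y] sub]
        H2_finite_range[OF P simple_function_Pair[OF X Y] sub])
qed

text \<open>Conditioning on the event keeps the space and the measurable sets, so \<open>X\<close>
  stays simple and only the point probabilities change. Values of \<open>X\<close> excluded by the
  event contribute 0.\<close>

lemma H2_event_eq:
  assumes P: "prob_space P" and X: "simple_function P X" and A: "X ` space P \<subseteq> A" "finite A"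
    and Y: "{\<omega> \<in> space P. Y \<omega> = y} \<in> sets P" and pos: "0 < \<P>(\<omega> in P. Y \<omega> = y)"
  shows "H2_event P X Y y = - (\<Sum>a\<in>A.
    \<P>(\<omega> in P. X \<omega> = a \<and> Y \<omega> = y) / \<P>(\<omega> in P. Y \<omega> = y) *
    log 2 (\<P>(\<omega> in P. X \<omega> = a \<and> Y \<omega> = y) / \<P>(\<omega> in P. Y \<omega> = y)))"
proof -
  interpret prob_space P by (rule P)
  let ?E = "{\<omega> \<in> space P. Y \<omega> = y}"
  have E: "emeasure P ?E \<noteq> 0" "emeasure P ?E \<noteq> \<infinity>"
    using pos by (auto simp: measure_def)
  have U: "prob_space (uniform_measure P ?E)"
    using E by (intro prob_space_uniform_measure) auto
  have "simple_function (uniform_measure P ?E) X"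
    using X by (simp add: simple_function_def)
  then have "H2_event P X Y y = - (\<Sum>a\<in>A. measure (uniform_measure P ?E) {\<omega> \<in> space P. X \<omega> = a} *
      log 2 (measure (uniform_measure P ?E) {\<omega> \<in> space P. X \<omega> = a}))"
    unfolding H2_event_def using H2_finite_range[OF U _ _ A(2)] A(1) by simp
  moreover have "measure (uniform_measure P ?E) {\<omega> \<in> space P. X \<omega> = a} =
      \<P>(\<omega> in P. X \<omega> = a \<and> Y \<omega> = y) / \<P>(\<omega> in P. Y \<omega> = y)" for a
  proof -
    have "{\<omega> \<in> space P. X \<omega> = a} \<in> events"
      using simple_functionD(2)[OF X, of "{a}"] by (simp add: vimage_def Int_def conj_commute)
    moreover have "?E \<inter> {\<omega> \<in> space P. X \<omega> = a} = {\<omega> \<in> space P. X \<omega> = a \<and> Y \<omega> = y}" by auto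
    ultimately show ?thesis
      using measure_uniform_measure[OF E, of "{\<omega> \<in> space P. X \<omega> = a}"] by simp
  qed
  ultimately show ?thesis by (simp only:)
qed

text \<open>Unconditional entropies only, so that the growth of each term can be read off from
  \<open>H2_partition\<close>.\<close>

lemma I2_eq:
  assumes P: "prob_space P" and X: "simple_function P X" and Y: "simple_function P Y"
  shows "I2 P X Y = H2 P X + H2 P Y - H2 P (\<lambda>\<omega>. (X \<omega>, Y \<omega>))"
proof -
  interpret prob_space P by (rule P)
  interpret information_space P 2 by standard simp
  show ?thesis
    using mutual_information_eq_entropy_conditional_entropy[OF X Y] H2_cond_eq[OF P X Y] by simp
qed

lemma prob_simple_function_sum:
  assumes P: "prob_space P" and X: "simple_function P X" and A: "X ` space P \<subseteq> A" "finite A"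
  shows "(\<Sum>a\<in>A. measure P {\<omega> \<in> space P. X \<omega> = a}) = 1"
proof -
  interpret prob_space P by (rule P)
  have "{\<omega> \<in> space P. X \<omega> = a} \<in> events" for a
    using simple_functionD(2)[OF X, of "{a}"] by (simp add: vimage_def Int_def conj_commute)
  then have "(\<Sum>a\<in>A. prob {\<omega> \<in> space P. X \<omega> = a}) = prob (\<Union>a\<in>A. {\<omega> \<in> space P. X \<omega> = a})"
    using A(2)
    by (intro finite_measure_finite_Union[symmetric]) (auto simp: disjoint_family_on_def)
  also have "(\<Union>a\<in>A. {\<omega> \<in> space P. X \<omega> = a}) = space P" using A(1) by auto
  finally show ?thesis by (simp add: prob_space)
qed

lemma simple_function_map:
  assumes "\<And>l. l \<in> set ls \<Longrightarrow> simple_function P (X l)"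
  shows "simple_function P (\<lambda>\<omega>. map (\<lambda>l. X l \<omega>) ls)"
  using assms
proof (induction ls)
  case (Cons l ls)
  then show ?case by (auto intro: simple_function_compose2[where h="(#)"])
qed simp

section \<open>Uniform measures and the outcome space of a scheme\<close>

text \<open>Both sides give each point the mass \<open>(1 / card W) ^ card I\<close>. The product
  form makes it possible to select coordinates with \<open>distr_PiM_reindex\<close>.\<close>

lemma uniform_count_measure_PiE:
  assumes I: "finite I" and W: "finite W" "W \<noteq> {}"
  shows "PiM I (\<lambda>_. uniform_count_measure W) = uniform_count_measure (I \<rightarrow>\<^sub>E W)"
proof (rule measure_eqI_finite)
  interpret product_prob_space "\<lambda>_. uniform_count_measure W" I
    using W by (intro product_prob_spaceI prob_space_uniform_count_measure) auto
  have fin: "finite (I \<rightarrow>\<^sub>E W)" using I W by (intro finite_PiE) auto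
  have "sets (PiM I (\<lambda>_. uniform_count_measure W)) = sets (PiM I (\<lambda>_. count_space W))"
    by (intro sets_PiM_cong) (auto simp: sets_uniform_count_measure)
  then show "sets (PiM I (\<lambda>_. uniform_count_measure W)) = Pow (I \<rightarrow>\<^sub>E W)"
    using I W by (simp add: count_space_PiM_finite countable_finite)
  show "sets (uniform_count_measure (I \<rightarrow>\<^sub>E W)) = Pow (I \<rightarrow>\<^sub>E W)"
    by (simp add: sets_uniform_count_measure)
  show "finite (I \<rightarrow>\<^sub>E W)" by (rule fin)
  fix f assume f: "f \<in> I \<rightarrow>\<^sub>E W"
  have card: "card (I \<rightarrow>\<^sub>E W) = card W ^ card I" using I by (simp add: card_PiE)
  have "emeasure (PiM I (\<lambda>_. uniform_count_measure W)) {f} =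
      emeasure (PiM I (\<lambda>_. uniform_count_measure W)) (\<Pi>\<^sub>E i\<in>I. {f i})"
    using f by (simp add: PiE_singleton PiE_iff)
  also have "\<dots> = (\<Prod>i\<in>I. emeasure (uniform_count_measure W) {f i})"
    using I f by (intro emeasure_PiM) (auto simp: sets_uniform_count_measure)
  also have "\<dots> = (\<Prod>i\<in>I. ennreal (1 / card W))"
    using W PiE_mem[OF f] by (intro prod.cong refl) (simp add: emeasure_uniform_count_measure)
  also have "\<dots> = ennreal (1 / card (I \<rightarrow>\<^sub>E W))"
    by (simp add: card ennreal_power power_divide)
  also have "\<dots> = emeasure (uniform_count_measure (I \<rightarrow>\<^sub>E W)) {f}"
    using f fin by (simp add: emeasure_uniform_count_measure)
  finally show "emeasure (PiM I (\<lambda>_. uniform_count_measure W)) {f} =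
    emeasure (uniform_count_measure (I \<rightarrow>\<^sub>E W)) {f}" .
qed

lemma nn_integral_uniform_count_measure:
  assumes "finite A"
  shows "(\<integral>\<^sup>+x. f x \<partial>uniform_count_measure A) = ennreal (1 / card A) * (\<Sum>x\<in>A. f x)"
  using assms
  by (simp add: uniform_count_measure_def nn_integral_point_measure_finite sum_distrib_left)

lemma prob_space_ir_space:
  assumes "prob_space (strategy C)" "1 \<le> N"
  shows "prob_space (ir_space N \<beta> C)"
  unfolding ir_space_def using assms
  by (intro prob_space_pair prob_space_uniform_count_measure finite_file_space file_space_nonempty) auto

lemma space_ir_space:
  "space (ir_space N \<beta> C) = {1..N} \<times> space (strategy C) \<times> file_space N \<beta>"
  by (simp add: ir_space_def space_pair_measure space_uniform_count_measure)

lemma simple_function_Mvar: "simple_function (ir_space N \<beta> C) Mvar"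
proof -
  have "Mvar \<in> ir_space N \<beta> C \<rightarrow>\<^sub>M count_space UNIV"
  proof -
    have "fst \<in> ir_space N \<beta> C \<rightarrow>\<^sub>M uniform_count_measure {1..N}" unfolding ir_space_def by simp
    moreover have "(\<lambda>x. x) \<in> uniform_count_measure {1..N} \<rightarrow>\<^sub>M count_space UNIV"
      by (auto simp: measurable_def sets_uniform_count_measure space_uniform_count_measure)
    ultimately have "(\<lambda>\<omega>. fst \<omega>) \<in> ir_space N \<beta> C \<rightarrow>\<^sub>M count_space UNIV"
      by (rule measurable_compose)
    then show ?thesis by (simp add: Mvar_def case_prod_unfold)
  qed
  moreover have "finite (Mvar ` space (ir_space N \<beta> C))"
    by (rule finite_subset[of _ "{1..N}"]) (auto simp: space_ir_space Mvar_def)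
  ultimately show ?thesis
    by (simp add: simple_function_eq_measurable)
qed

lemma simple_function_files:
  fixes C :: "('s, 'q, 'x::finite, 'a) ir_scheme"
  shows "simple_function (ir_space N \<beta> C) (\<lambda>\<omega>. snd (snd \<omega>))"
proof -
  have "(\<lambda>\<omega>. snd (snd \<omega>)) \<in> ir_space N \<beta> C \<rightarrow>\<^sub>M count_space UNIV"
  proof -
    have "(\<lambda>\<omega>. snd (snd \<omega>)) \<in> ir_space N \<beta> C \<rightarrow>\<^sub>M uniform_count_measure (file_space N \<beta>)"
      unfolding ir_space_def by simp
    moreover have "(\<lambda>x. x) \<in> uniform_count_measure (file_space N \<beta>) \<rightarrow>\<^sub>M count_space UNIV"
      by (auto simp: measurable_def sets_uniform_count_measure space_uniform_count_measure)
    ultimately show ?thesis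
      by (rule measurable_compose)
  qed
  moreover have "finite ((\<lambda>\<omega>. snd (snd \<omega>)) ` space (ir_space N \<beta> C))"
    by (rule finite_subset[OF _ finite_file_space]) (auto simp: space_ir_space)
  ultimately show ?thesis
    by (simp add: simple_function_eq_measurable)
qed

lemma simple_function_requested_file:
  fixes C :: "('s, 'q, 'x::finite, 'a) ir_scheme"
  shows "simple_function (ir_space N \<beta> C) requested_file"
proof -
  have "(requested_file :: nat \<times> 's \<times> (nat \<Rightarrow> 'x list) \<Rightarrow> 'x list) = (\<lambda>\<omega>. snd (snd \<omega>) (Mvar \<omega>))"
    by (auto simp: requested_file_def Mvar_def)
  moreover have "simple_function (ir_space N \<beta> C) (\<lambda>\<omega>. snd (snd \<omega>) (Mvar \<omega>))"
    by (rule simple_function_compose2[OF simple_function_files simple_function_Mvar, where h="\<lambda>X m. X m"])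
  ultimately show ?thesis by (simp only:)
qed

text \<open>Measurability is known only for each fixed request \<open>m\<close>. Requests are finite
  in number, so a query event is a finite union of rectangles and thus measurable jointly.\<close>

lemma simple_function_Qvar:
  assumes fin: "finite (queries C l)"
    and meas: "\<And>m. m \<in> {1..N} \<Longrightarrow> query C l m \<in> strategy C \<rightarrow>\<^sub>M count_space (queries C l)"
  shows "simple_function (ir_space N \<beta> C) (Qvar C l)"
proof -
  have sub: "Qvar C l ` space (ir_space N \<beta> C) \<subseteq> queries C l"
    using measurable_space[OF meas] by (auto simp: space_ir_space Qvar_def)
  have "Qvar C l -` {q} \<inter> space (ir_space N \<beta> C) \<in> sets (ir_space N \<beta> C)"
    if q: "q \<in> queries C l" for q
  proof -
    have "Qvar C l -` {q} \<inter> space (ir_space N \<beta> C) =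
        (\<Union>m\<in>{1..N}. {m} \<times> (query C l m -` {q} \<inter> space (strategy C)) \<times> file_space N \<beta>)"
      by (auto simp: space_ir_space Qvar_def)
    also have "\<dots> \<in> sets (ir_space N \<beta> C)"
      unfolding ir_space_def using q
      by (intro sets.finite_UN pair_measureI measurable_sets[OF meas])
        (auto simp: sets_uniform_count_measure)
    finally show ?thesis .
  qed
  then show ?thesis
    using sub finite_subset[OF sub fin] by (auto simp: simple_function_def)
qed

lemma simple_function_Avar:
  fixes C :: "('s, 'q, 'x::finite, 'a) ir_scheme"
  assumes "simple_function (ir_space N \<beta> C) (Qvar C l)"
  shows "simple_function (ir_space N \<beta> C) (Avar C l)"
proof -
  have "Avar C l = (\<lambda>\<omega>. answer C l (Qvar C l \<omega>) (snd (snd \<omega>)))"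
    by (auto simp: Avar_def Qvar_def)
  then show ?thesis
    using simple_function_compose2[OF assms simple_function_files, where h="answer C l"] by simp
qed


text \<open>Fubini in the first coordinate: averaging over slices lets \<open>pos\<close> act as a
  mere reindexing of a finite sum.\<close>

lemma emeasure_ir_space:
  fixes C :: "('s, 'q, 'x::finite, 'a) ir_scheme"
  assumes S: "prob_space (strategy C)" and E: "E \<in> sets (ir_space N \<beta> C)"
  shows "emeasure (ir_space N \<beta> C) E = ennreal (1 / N) *
    (\<Sum>m\<in>{1..N}. emeasure (strategy C \<Otimes>\<^sub>M uniform_count_measure (file_space N \<beta>)) (Pair m -` E))"
proof -
  interpret T: prob_space "strategy C \<Otimes>\<^sub>M uniform_count_measure (file_space N \<beta> :: (nat \<Rightarrow> 'x list) set)"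
    using S by (intro prob_space_pair prob_space_uniform_count_measure finite_file_space file_space_nonempty)
  show ?thesis
    using E unfolding ir_space_def
    by (simp add: T.emeasure_pair_measure_alt nn_integral_uniform_count_measure)
qed

section \<open>Joint law of partition number and projected outcome\<close>

locale partitioned_scheme =
  fixes C :: "('s, 'q, 'x::finite, 'a::finite) ir_scheme" and pos :: "nat \<Rightarrow> nat \<times> nat"
    and M n \<eta> \<beta> N :: nat
  assumes M_pos: "1 \<le> M" and \<eta>_pos: "1 \<le> \<eta>" and \<eta>_dvd: "\<eta> dvd M" and N_def: "N = M div \<eta>"
    and scheme: "is_ir_scheme N n \<beta> C" and partition: "equal_partition M \<eta> pos"
begin

abbreviation "P \<equiv> partition_scheme M \<eta> pos C"

definition part :: "nat \<times> 's \<times> (nat \<Rightarrow> 'x list) \<Rightarrow> nat" where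
  "part = (\<lambda>(m, s, X). fst (pos m))"

definition proj :: "nat \<times> 's \<times> (nat \<Rightarrow> 'x list) \<Rightarrow> nat \<times> 's \<times> (nat \<Rightarrow> 'x list)" where
  "proj = (\<lambda>(m, s, X). (snd (pos m), s, partition_files M \<eta> pos (fst (pos m)) X))"

lemma M_eq: "M = \<eta> * N"
  using \<eta>_dvd by (simp add: N_def)

lemma N_pos: "1 \<le> N"
  using M_pos M_eq by (cases N) auto

lemma prob_space_strategy: "prob_space (strategy C)"
  using scheme by (simp add: is_ir_scheme_def)

lemma finite_queries: "l \<in> {1..n} \<Longrightarrow> finite (queries C l)"
  using scheme by (simp add: is_ir_scheme_def)

lemma measurable_query:
  "l \<in> {1..n} \<Longrightarrow> i \<in> {1..N} \<Longrightarrow> query C l i \<in> strategy C \<rightarrow>\<^sub>M count_space (queries C l)"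
  using scheme by (simp add: is_ir_scheme_def)

lemma bij_pos: "bij_betw pos {1..M} ({1..\<eta>} \<times> {1..N})"
  using partition by (simp add: equal_partition_def N_def)

lemma pos_mem: "m \<in> {1..M} \<Longrightarrow> fst (pos m) \<in> {1..\<eta>} \<and> snd (pos m) \<in> {1..N}"
  using bij_betwE[OF bij_pos] by (simp add: mem_Times_iff)

lemma strategy_P [simp]: "strategy P = strategy C"
  and queries_P: "queries P l = queries C l \<times> {1..\<eta>}"
  and query_P: "query P l m s = (query C l (snd (pos m)) s, fst (pos m))"
  by (simp_all add: partition_scheme_def)

lemma prob_space_C: "prob_space (ir_space N \<beta> C)"
  by (intro prob_space_ir_space prob_space_strategy N_pos)

lemma prob_space_P: "prob_space (ir_space M \<beta> P)"
  using prob_space_strategy M_pos by (intro prob_space_ir_space) auto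

lemma partition_files_mem:
  assumes "X \<in> file_space M \<beta>" "j \<in> {1..\<eta>}"
  shows "partition_files M \<eta> pos j X \<in> file_space N \<beta>"
proof -
  have "inv_into {1..M} pos (j, i) \<in> {1..M}" if "i \<in> {1..N}" for i
    using bij_betwE[OF bij_betw_inv_into[OF bij_pos]] assms that by blast
  then show ?thesis
    using assms by (auto simp: partition_files_def file_space_def N_def PiE_iff)
qed

text \<open>For fixed \<open>j\<close> the map from positions to file numbers is injective, and
  distinct coordinates of a product of identical probability measures again have the product
  law.\<close>

lemma distr_partition_files:
  assumes j: "j \<in> {1..\<eta>}"
  shows "distr (uniform_count_measure (file_space M \<beta>)) (uniform_count_measure (file_space N \<beta>))
    (partition_files M \<eta> pos j) = uniform_count_measure (file_space N \<beta> :: (nat \<Rightarrow> 'x list) set)"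
proof -
  let ?W = "{w :: 'x list. length w = \<beta>}" and ?f = "\<lambda>i. inv_into {1..M} pos (j, i)"
  have W: "finite ?W" "?W \<noteq> {}"
    using finite_lists_length_eq[of "UNIV :: 'x set" \<beta>] Ex_list_of_length[of \<beta>] by simp_all
  have inv: "bij_betw (inv_into {1..M} pos) ({1..\<eta>} \<times> {1..N}) {1..M}"
    by (rule bij_betw_inv_into[OF bij_pos])
  have "distr (PiM {1..M} (\<lambda>_. uniform_count_measure ?W)) (PiM {1..N} (\<lambda>_. uniform_count_measure ?W))
      (\<lambda>X. \<lambda>i\<in>{1..N}. X (?f i)) = PiM {1..N} (\<lambda>_. uniform_count_measure ?W)"
  proof (rule distr_PiM_reindex)
    show "prob_space (uniform_count_measure ?W)"
      using W by (intro prob_space_uniform_count_measure)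
    show "inj_on ?f {1..N}"
    proof (rule inj_onI)
      fix i i' assume "i \<in> {1..N}" "i' \<in> {1..N}" "?f i = ?f i'"
      then have "(j, i) = (j, i')"
        using j by (intro inj_onD[OF bij_betw_imp_inj_on[OF inv]]) auto
      then show "i = i'" by simp
    qed
    show "?f \<in> {1..N} \<rightarrow> {1..M}"
    proof
      fix i assume "i \<in> {1..N}"
      then show "?f i \<in> {1..M}" using bij_betwE[OF inv] j by blast
    qed
  qed
  moreover have "PiM {1..K} (\<lambda>_. uniform_count_measure ?W) = uniform_count_measure (file_space K \<beta>)" for K :: nat
    unfolding file_space_def by (rule uniform_count_measure_PiE[OF finite_atLeastAtMost W])
  moreover have "partition_files M \<eta> pos j = (\<lambda>X :: nat \<Rightarrow> 'x list. \<lambda>i\<in>{1..N}. X (?f i))"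
    by (simp add: partition_files_def N_def fun_eq_iff)
  ultimately show ?thesis
    by (simp only:)
qed

lemma measurable_strategy_files:
  assumes j: "j \<in> {1..\<eta>}"
  shows "(\<lambda>(s, X). (s, partition_files M \<eta> pos j X))
    \<in> strategy C \<Otimes>\<^sub>M uniform_count_measure (file_space M \<beta>)
      \<rightarrow>\<^sub>M strategy C \<Otimes>\<^sub>M uniform_count_measure (file_space N \<beta>)"
proof -
  have [measurable]: "partition_files M \<eta> pos j
      \<in> uniform_count_measure (file_space M \<beta>) \<rightarrow>\<^sub>M uniform_count_measure (file_space N \<beta>)"
    using partition_files_mem j
    by (auto simp: measurable_def sets_uniform_count_measure space_uniform_count_measure)
  show ?thesis by measurable
qed

lemma distr_strategy_files:
  assumes j: "j \<in> {1..\<eta>}"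
  shows "distr (strategy C \<Otimes>\<^sub>M uniform_count_measure (file_space M \<beta>))
      (strategy C \<Otimes>\<^sub>M uniform_count_measure (file_space N \<beta>))
      (\<lambda>(s, X). (s, partition_files M \<eta> pos j X)) =
    strategy C \<Otimes>\<^sub>M uniform_count_measure (file_space N \<beta> :: (nat \<Rightarrow> 'x list) set)"
proof -
  interpret F: prob_space "uniform_count_measure (file_space N \<beta> :: (nat \<Rightarrow> 'x list) set)"
    by (intro prob_space_uniform_count_measure finite_file_space file_space_nonempty)
  have "partition_files M \<eta> pos j
      \<in> uniform_count_measure (file_space M \<beta>) \<rightarrow>\<^sub>M uniform_count_measure (file_space N \<beta> :: (nat \<Rightarrow> 'x list) set)"
    using partition_files_mem j
    by (auto simp: measurable_def sets_uniform_count_measure space_uniform_count_measure)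
  from pair_measure_distr[OF measurable_ident[of "strategy C"] this]
  show ?thesis
    by (simp add: distr_partition_files[OF j] F.sigma_finite_measure_axioms id_def)
qed

lemma proj_mem:
  assumes "\<omega> \<in> space (ir_space M \<beta> P)"
  shows "part \<omega> \<in> {1..\<eta>}" "proj \<omega> \<in> space (ir_space N \<beta> C)"
  using assms pos_mem[of "fst \<omega>"]
  by (auto simp: space_ir_space part_def proj_def intro!: partition_files_mem)

text \<open>Slice by the request \<open>m\<close>. The slice is empty unless \<open>m\<close> lies
  in partition \<open>j\<close>; otherwise it is the preimage of the slice of \<open>E\<close> at
  \<open>snd (pos m)\<close> and has the same probability by \<open>distr_strategy_files\<close>. As
  \<open>m\<close> runs through partition \<open>j\<close>, \<open>snd (pos m)\<close> meets each
  index in \<open>{1..N}\<close> once, and \<open>1 / M\<close> factors as \<open>1 / \<eta>\<close>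
  times \<open>1 / N\<close>.\<close>

lemma
  assumes j: "j \<in> {1..\<eta>}" and E: "E \<in> sets (ir_space N \<beta> C)"
  shows sets_partition_event:
      "{\<omega> \<in> space (ir_space M \<beta> P). part \<omega> = j \<and> proj \<omega> \<in> E} \<in> sets (ir_space M \<beta> P)"
    and emeasure_partition_event:
      "emeasure (ir_space M \<beta> P) {\<omega> \<in> space (ir_space M \<beta> P). part \<omega> = j \<and> proj \<omega> \<in> E} =
        ennreal (1 / \<eta>) * emeasure (ir_space N \<beta> C) E"
proof -
  let ?A = "{\<omega> \<in> space (ir_space M \<beta> P). part \<omega> = j \<and> proj \<omega> \<in> E}"
  let ?SM = "strategy C \<Otimes>\<^sub>M uniform_count_measure (file_space M \<beta>)"
  let ?SN = "strategy C \<Otimes>\<^sub>M uniform_count_measure (file_space N \<beta>)"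
  let ?g = "\<lambda>(s, X). (s, partition_files M \<eta> pos j X)"
  let ?G = "\<lambda>i. ?g -` (Pair i -` E) \<inter> space ?SM"
  have space_SM: "space ?SM = space (strategy C) \<times> file_space M \<beta>"
    by (simp add: space_pair_measure space_uniform_count_measure)
  have sets_E: "Pair i -` E \<in> sets ?SN" for i
    using E unfolding ir_space_def by (rule sets_Pair1)
  have G: "?G i \<in> sets ?SM" for i
    by (rule measurable_sets[OF measurable_strategy_files[OF j] sets_E])
  have "?A = (\<Union>m\<in>{m\<in>{1..M}. fst (pos m) = j}. {m} \<times> ?G (snd (pos m)))"
    by (auto simp: space_ir_space space_SM part_def proj_def)
  also have "\<dots> \<in> sets (ir_space M \<beta> P)"
    unfolding ir_space_def strategy_P using G
    by (intro sets.finite_UN pair_measureI) (auto simp: sets_uniform_count_measure)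
  finally show A: "?A \<in> sets (ir_space M \<beta> P)" .
  have slice: "Pair m -` ?A = (if fst (pos m) = j then ?G (snd (pos m)) else {})"
    if "m \<in> {1..M}" for m
    using that by (auto simp: space_ir_space space_SM part_def proj_def)
  have G_eq: "emeasure ?SM (?G i) = emeasure ?SN (Pair i -` E)" for i
    using emeasure_distr[OF measurable_strategy_files[OF j] sets_E]
    by (simp only: distr_strategy_files[OF j])
  have "emeasure (ir_space M \<beta> P) ?A = ennreal (1 / M) * (\<Sum>m\<in>{1..M}. emeasure ?SM (Pair m -` ?A))"
    using emeasure_ir_space[OF _ A] prob_space_strategy by simp
  also have "(\<Sum>m\<in>{1..M}. emeasure ?SM (Pair m -` ?A)) =
      (\<Sum>m\<in>{1..M}. (\<lambda>(j', i). if j' = j then emeasure ?SN (Pair i -` E) else 0) (pos m))"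
  proof (intro sum.cong refl)
    fix m assume m: "m \<in> {1..M}"
    show "emeasure ?SM (Pair m -` ?A) =
        (\<lambda>(j', i). if j' = j then emeasure ?SN (Pair i -` E) else 0) (pos m)"
      unfolding slice[OF m] using G_eq[of "snd (pos m)"] by (simp add: case_prod_unfold)
  qed
  also have "\<dots> = (\<Sum>(j', i)\<in>{1..\<eta>} \<times> {1..N}. if j' = j then emeasure ?SN (Pair i -` E) else 0)"
    by (rule sum.reindex_bij_betw[OF bij_pos])
  also have "\<dots> = (\<Sum>j'\<in>{1..\<eta>}. if j' = j then (\<Sum>i\<in>{1..N}. emeasure ?SN (Pair i -` E)) else 0)"
    unfolding sum.cartesian_product[symmetric] by (intro sum.cong refl) simp
  also have "\<dots> = (\<Sum>i\<in>{1..N}. emeasure ?SN (Pair i -` E))"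
    using j by simp
  also have "ennreal (1 / M) = ennreal (1 / \<eta>) * ennreal (1 / N)"
    by (simp add: M_eq flip: ennreal_mult)
  finally show "emeasure (ir_space M \<beta> P) ?A = ennreal (1 / \<eta>) * emeasure (ir_space N \<beta> C) E"
    using emeasure_ir_space[OF prob_space_strategy E] by (simp add: mult.assoc)
qed

lemma measure_partition_event:
  assumes "j \<in> {1..\<eta>}" "E \<in> sets (ir_space N \<beta> C)"
  shows "measure (ir_space M \<beta> P) {\<omega> \<in> space (ir_space M \<beta> P). part \<omega> = j \<and> proj \<omega> \<in> E} =
    measure (ir_space N \<beta> C) E / \<eta>"
  using emeasure_partition_event[OF assms] by (simp add: measure_def enn2real_mult)

text \<open>The \<eta> disjoint partition events each carry a fraction \<open>1 / \<eta>\<close> of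
  the mass of \<open>E\<close>. This marginal law is what transfers expected answer lengths and
  access numbers.\<close>

lemma
  shows measurable_proj: "proj \<in> ir_space M \<beta> P \<rightarrow>\<^sub>M ir_space N \<beta> C"
    and distr_proj: "distr (ir_space M \<beta> P) (ir_space N \<beta> C) proj = ir_space N \<beta> C"
proof -
  let ?A = "\<lambda>E j. {\<omega> \<in> space (ir_space M \<beta> P). part \<omega> = j \<and> proj \<omega> \<in> E}"
  have vimage: "proj -` E \<inter> space (ir_space M \<beta> P) = (\<Union>j\<in>{1..\<eta>}. ?A E j)" for E
    using proj_mem by auto
  have meas: "proj -` E \<inter> space (ir_space M \<beta> P) \<in> sets (ir_space M \<beta> P)"
    if "E \<in> sets (ir_space N \<beta> C)" for E
    unfolding vimage using sets_partition_event that by (intro sets.finite_UN) auto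
  show proj: "proj \<in> ir_space M \<beta> P \<rightarrow>\<^sub>M ir_space N \<beta> C"
    using proj_mem meas by (intro measurableI) auto
  show "distr (ir_space M \<beta> P) (ir_space N \<beta> C) proj = ir_space N \<beta> C"
  proof (rule measure_eqI)
    fix E assume "E \<in> sets (distr (ir_space M \<beta> P) (ir_space N \<beta> C) proj)"
    then have E: "E \<in> sets (ir_space N \<beta> C)" by simp
    have "emeasure (distr (ir_space M \<beta> P) (ir_space N \<beta> C) proj) E =
        emeasure (ir_space M \<beta> P) (\<Union>j\<in>{1..\<eta>}. ?A E j)"
      by (simp add: emeasure_distr[OF proj E] vimage)
    also have "\<dots> = (\<Sum>j\<in>{1..\<eta>}. emeasure (ir_space M \<beta> P) (?A E j))"
      using sets_partition_event[OF _ E]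
      by (intro sum_emeasure[symmetric]) (auto simp: disjoint_family_on_def)
    also have "\<dots> = of_nat \<eta> * ennreal (1 / \<eta>) * emeasure (ir_space N \<beta> C) E"
      by (simp add: emeasure_partition_event[OF _ E] mult.assoc)
    also have "of_nat \<eta> * ennreal (1 / \<eta>) = 1"
      using \<eta>_pos by (simp add: ennreal_of_nat_eq_real_of_nat flip: ennreal_mult)
    finally show "emeasure (distr (ir_space M \<beta> P) (ir_space N \<beta> C) proj) E = emeasure (ir_space N \<beta> C) E"
      by simp
  qed simp
qed

lemma integral_proj:
  fixes f :: "_ \<Rightarrow> real"
  assumes "simple_function (ir_space N \<beta> C) f"
  shows "(\<integral>\<omega>. f (proj \<omega>) \<partial>ir_space M \<beta> P) = (\<integral>\<omega>. f \<omega> \<partial>ir_space N \<beta> C)"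
  using integral_distr[OF measurable_proj borel_measurable_simple_function[OF assms]]
  by (simp add: distr_proj)

section \<open>Growth of entropy by the partition number\<close>

text \<open>Each value of \<open>G\<close> of probability \<open>p\<close> splits into \<eta> values
  of \<open>X\<close>, each of probability \<open>p / \<eta>\<close>; the term
  \<open>log 2 \<eta>\<close> comes out with weight equal to the sum of all \<open>p\<close>, which
  is 1. The recoding \<open>h\<close> allows \<open>X\<close> to store the pair in any form, and
  need be injective only on pairs that can occur.\<close>

lemma H2_partition:
  assumes G: "simple_function (ir_space N \<beta> C) G" and X: "simple_function (ir_space M \<beta> P) X"
    and h: "inj_on h ({1..\<eta>} \<times> G ` space (ir_space N \<beta> C))"
    and X_eq: "\<And>\<omega>. \<omega> \<in> space (ir_space M \<beta> P) \<Longrightarrow> X \<omega> = h (part \<omega>, G (proj \<omega>))"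
  shows "H2 (ir_space M \<beta> P) X = H2 (ir_space N \<beta> C) G + log 2 \<eta>"
proof -
  let ?B = "G ` space (ir_space N \<beta> C)"
  let ?p = "\<lambda>g. measure (ir_space N \<beta> C) {\<omega> \<in> space (ir_space N \<beta> C). G \<omega> = g}"
  let ?r = "\<lambda>x. measure (ir_space M \<beta> P) {\<omega> \<in> space (ir_space M \<beta> P). X \<omega> = x}"
  have fin: "finite ?B" by (rule simple_functionD(1)[OF G])
  have r: "?r (h (j, g)) = ?p g / \<eta>" if j: "j \<in> {1..\<eta>}" and g: "g \<in> ?B" for j g
  proof -
    have "X \<omega> = h (j, g) \<longleftrightarrow> part \<omega> = j \<and> G (proj \<omega>) = g" if "\<omega> \<in> space (ir_space M \<beta> P)" for \<omega>
      using inj_on_eq_iff[OF h, of "(part \<omega>, G (proj \<omega>))" "(j, g)"] proj_mem[OF that] j g X_eq[OF that]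
      by auto
    then have "{\<omega> \<in> space (ir_space M \<beta> P). X \<omega> = h (j, g)} = {\<omega> \<in> space (ir_space M \<beta> P).
        part \<omega> = j \<and> proj \<omega> \<in> {\<omega> \<in> space (ir_space N \<beta> C). G \<omega> = g}}"
      using proj_mem by auto
    moreover have "{\<omega> \<in> space (ir_space N \<beta> C). G \<omega> = g} \<in> sets (ir_space N \<beta> C)"
      using simple_functionD(2)[OF G, of "{g}"] by (simp add: vimage_def Int_def conj_commute)
    ultimately show ?thesis
      using measure_partition_event[OF j, of "{\<omega> \<in> space (ir_space N \<beta> C). G \<omega> = g}"] by (simp only:)
  qed
  \<comment> \<open>The logarithm of the quotient splits only for positive \<open>?p g\<close>; at 0
    both sides vanish through the factor in front.\<close>
  have summand: "?p g / \<eta> * log 2 (?p g / \<eta>) = (?p g * log 2 (?p g) - ?p g * log 2 \<eta>) / \<eta>" for g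
    using \<eta>_pos measure_nonneg[of "ir_space N \<beta> C" "{\<omega> \<in> space (ir_space N \<beta> C). G \<omega> = g}"]
    by (cases "?p g = 0") (simp_all add: log_divide right_diff_distrib diff_divide_distrib)
  have "H2 (ir_space M \<beta> P) X = - (\<Sum>x\<in>h ` ({1..\<eta>} \<times> ?B). ?r x * log 2 (?r x))"
    using fin X_eq proj_mem by (intro H2_finite_range prob_space_P X) auto
  also have "(\<Sum>x\<in>h ` ({1..\<eta>} \<times> ?B). ?r x * log 2 (?r x)) =
      (\<Sum>(j, g)\<in>{1..\<eta>} \<times> ?B. ?r (h (j, g)) * log 2 (?r (h (j, g))))"
    by (subst sum.reindex[OF h]) (simp add: case_prod_unfold)
  also have "\<dots> = (\<Sum>(j, g)\<in>{1..\<eta>} \<times> ?B. (?p g * log 2 (?p g) - ?p g * log 2 \<eta>) / \<eta>)"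
  proof (intro sum.cong refl)
    fix x assume "x \<in> {1..\<eta>} \<times> ?B"
    then obtain j g where "x = (j, g)" "j \<in> {1..\<eta>}" "g \<in> ?B" by blast
    then show "(case x of (j, g) \<Rightarrow> ?r (h (j, g)) * log 2 (?r (h (j, g)))) =
        (case x of (j, g) \<Rightarrow> (?p g * log 2 (?p g) - ?p g * log 2 \<eta>) / \<eta>)"
      using r summand by (simp only: prod.case)
  qed
  also have "\<dots> = (\<Sum>g\<in>?B. ?p g * log 2 (?p g) - ?p g * log 2 \<eta>)"
    using \<eta>_pos by (simp add: sum.cartesian_product[symmetric] flip: sum_divide_distrib)
  also have "\<dots> = (\<Sum>g\<in>?B. ?p g * log 2 (?p g)) - log 2 \<eta>"
    using prob_simple_function_sum[OF prob_space_C G subset_refl fin]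
    by (simp add: sum_subtractf flip: sum_distrib_right)
  finally show ?thesis
    using H2_finite_range[OF prob_space_C G subset_refl fin] by simp
qed

section \<open>Queries, answers and requests expressed through the projection\<close>

lemma measurable_query_P:
  assumes "l \<in> {1..n}" "m \<in> {1..M}"
  shows "query P l m \<in> strategy P \<rightarrow>\<^sub>M count_space (queries P l)"
proof -
  have "query C l (snd (pos m)) \<in> strategy C \<rightarrow>\<^sub>M count_space (queries C l)"
    using assms pos_mem by (intro measurable_query) auto
  moreover have "(\<lambda>q. (q, fst (pos m))) \<in> count_space (queries C l) \<rightarrow>\<^sub>M count_space (queries C l \<times> {1..\<eta>})"
    using pos_mem[OF assms(2)] by simp
  ultimately have "(\<lambda>s. (query C l (snd (pos m)) s, fst (pos m)))
      \<in> strategy C \<rightarrow>\<^sub>M count_space (queries C l \<times> {1..\<eta>})"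
    by (rule measurable_compose)
  moreover have "query P l m = (\<lambda>s. (query C l (snd (pos m)) s, fst (pos m)))"
    by (simp add: query_P fun_eq_iff)
  ultimately show ?thesis
    by (simp only: strategy_P queries_P)
qed

lemma simple_function_Qvar_C: "l \<in> {1..n} \<Longrightarrow> simple_function (ir_space N \<beta> C) (Qvar C l)"
  by (intro simple_function_Qvar finite_queries measurable_query)

lemma simple_function_Qvar_P: "l \<in> {1..n} \<Longrightarrow> simple_function (ir_space M \<beta> P) (Qvar P l)"
  by (intro simple_function_Qvar measurable_query_P) (simp_all add: queries_P finite_queries)

lemma Qvar_P: "Qvar P l \<omega> = (Qvar C l (proj \<omega>), part \<omega>)"
  by (simp add: Qvar_def proj_def part_def query_P case_prod_unfold)

lemma Avar_P: "Avar P l \<omega> = Avar C l (proj \<omega>)"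
  by (simp add: Avar_def proj_def query_P case_prod_unfold) (simp add: partition_scheme_def)

lemma inj_on_inv_pos: "inj_on (inv_into {1..M} pos) ({1..\<eta>} \<times> {1..N})"
  by (rule bij_betw_imp_inj_on[OF bij_betw_inv_into[OF bij_pos]])

lemma Mvar_P:
  assumes "\<omega> \<in> space (ir_space M \<beta> P)"
  shows "Mvar \<omega> = inv_into {1..M} pos (part \<omega>, Mvar (proj \<omega>))"
proof -
  have "fst \<omega> \<in> {1..M}" using assms by (auto simp: space_ir_space)
  then show ?thesis
    using bij_betw_inv_into_left[OF bij_pos, of "fst \<omega>"]
    by (simp add: Mvar_def part_def proj_def case_prod_unfold)
qed

text \<open>\<open>inv_into\<close> undoes \<open>pos\<close> at the request, so position
  \<open>snd (pos m)\<close> of the selected files holds file \<open>m\<close>; that position lies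
  in \<open>{1..N}\<close>, where the restricted function is defined.\<close>

lemma requested_file_P:
  assumes "\<omega> \<in> space (ir_space M \<beta> P)"
  shows "requested_file \<omega> = requested_file (proj \<omega>)"
proof -
  have m: "fst \<omega> \<in> {1..M}" using assms by (auto simp: space_ir_space)
  then show ?thesis
    using bij_betw_inv_into_left[OF bij_pos m] pos_mem[OF m]
    by (simp add: requested_file_def proj_def partition_files_def N_def case_prod_unfold)
qed

lemma Mvar_mem: "\<omega> \<in> space (ir_space N \<beta> C) \<Longrightarrow> Mvar \<omega> \<in> {1..N}"
  by (auto simp: space_ir_space Mvar_def)

lemma H2_Mvar: "H2 (ir_space M \<beta> P) Mvar = H2 (ir_space N \<beta> C) Mvar + log 2 \<eta>"
proof (rule H2_partition[where h = "inv_into {1..M} pos"])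
  show "inj_on (inv_into {1..M} pos) ({1..\<eta>} \<times> Mvar ` space (ir_space N \<beta> C))"
    by (rule inj_on_subset[OF inj_on_inv_pos]) (use Mvar_mem in blast)
qed (use simple_function_Mvar Mvar_P in auto)

lemma H2_Qvar:
  assumes l: "l \<in> {1..n}"
  shows "H2 (ir_space M \<beta> P) (Qvar P l) = H2 (ir_space N \<beta> C) (Qvar C l) + log 2 \<eta>"
  by (rule H2_partition[OF simple_function_Qvar_C[OF l] simple_function_Qvar_P[OF l], where h = prod.swap])
    (simp_all add: Qvar_P)

text \<open>The partition number is contained in the request and repeated in the query, but the pair
  carries it only once. The separate entropies grow by two \<open>log 2 \<eta>\<close>, the joint
  one by a single one, and the mutual information by the difference.\<close>

lemma H2_Mvar_Qvar:
  assumes l: "l \<in> {1..n}"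
  shows "H2 (ir_space M \<beta> P) (\<lambda>\<omega>. (Mvar \<omega>, Qvar P l \<omega>)) =
    H2 (ir_space N \<beta> C) (\<lambda>\<omega>. (Mvar \<omega>, Qvar C l \<omega>)) + log 2 \<eta>"
proof (rule H2_partition[OF simple_function_Pair[OF simple_function_Mvar simple_function_Qvar_C[OF l]]
      simple_function_Pair[OF simple_function_Mvar simple_function_Qvar_P[OF l]],
      where h = "\<lambda>(j, i, q). (inv_into {1..M} pos (j, i), q, j)"])
  show "inj_on (\<lambda>(j, i, q). (inv_into {1..M} pos (j, i), q, j))
      ({1..\<eta>} \<times> (\<lambda>\<omega>. (Mvar \<omega>, Qvar C l \<omega>)) ` space (ir_space N \<beta> C))"
  proof (rule inj_onI)
    fix x y assume x: "x \<in> {1..\<eta>} \<times> (\<lambda>\<omega>. (Mvar \<omega>, Qvar C l \<omega>)) ` space (ir_space N \<beta> C)"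
      and y: "y \<in> {1..\<eta>} \<times> (\<lambda>\<omega>. (Mvar \<omega>, Qvar C l \<omega>)) ` space (ir_space N \<beta> C)"
      and eq: "(\<lambda>(j, i, q). (inv_into {1..M} pos (j, i), q, j)) x =
        (\<lambda>(j, i, q). (inv_into {1..M} pos (j, i), q, j)) y"
    have "(fst x, fst (snd x)) \<in> {1..\<eta>} \<times> {1..N}" "(fst y, fst (snd y)) \<in> {1..\<eta>} \<times> {1..N}"
      using x y Mvar_mem by auto
    moreover have "inv_into {1..M} pos (fst x, fst (snd x)) = inv_into {1..M} pos (fst y, fst (snd y))"
      "snd (snd x) = snd (snd y)"
      using eq by (auto simp: case_prod_unfold)
    ultimately show "x = y"
      using inj_onD[OF inj_on_inv_pos] by (metis prod.collapse prod.inject)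
  qed
qed (simp add: Mvar_P Qvar_P)

section \<open>Costs and retrieval\<close>

lemma upload_cost_P: "upload_cost M n \<beta> P = upload_cost N n \<beta> C + n * log 2 \<eta>"
  by (simp add: upload_cost_def H2_Qvar sum.distrib del: atLeastAtMost_iff cong: sum.cong_simp)

lemma download_cost_P: "download_cost M n \<beta> P = download_cost N n \<beta> C"
proof -
  have "(\<integral>\<omega>. real (ans_len P l (Qvar P l \<omega>)) \<partial>ir_space M \<beta> P) =
      (\<integral>\<omega>. real (ans_len C l (Qvar C l \<omega>)) \<partial>ir_space N \<beta> C)" if "l \<in> {1..n}" for l
    using integral_proj[OF simple_function_compose1[OF simple_function_Qvar_C[OF that],
          where g = "\<lambda>q. real (ans_len C l q)"]]
    by (simp add: Qvar_P) (simp add: partition_scheme_def)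
  then show ?thesis by (simp add: download_cost_def)
qed

lemma access_complexity_P: "access_complexity M n \<beta> P = access_complexity N n \<beta> C"
proof -
  have "(\<integral>\<omega>. real (accesses P l (Qvar P l \<omega>)) \<partial>ir_space M \<beta> P) =
      (\<integral>\<omega>. real (accesses C l (Qvar C l \<omega>)) \<partial>ir_space N \<beta> C)" if "l \<in> {1..n}" for l
    using integral_proj[OF simple_function_compose1[OF simple_function_Qvar_C[OF that],
          where g = "\<lambda>q. real (accesses C l q)"]]
    by (simp add: Qvar_P) (simp add: partition_scheme_def)
  then show ?thesis by (simp add: access_complexity_def)
qed

lemma rate_P: "rate M n \<beta> P = rate N n \<beta> C"
  by (simp add: rate_def download_cost_P)

lemma retrieval_P:
  "H2_cond (ir_space M \<beta> P) requested_file
     (\<lambda>\<omega>. (map (\<lambda>l. Avar P l \<omega>) [1..<Suc n], map (\<lambda>l. Qvar P l \<omega>) [1..<Suc n], Mvar \<omega>)) =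
   H2_cond (ir_space N \<beta> C) requested_file
     (\<lambda>\<omega>. (map (\<lambda>l. Avar C l \<omega>) [1..<Suc n], map (\<lambda>l. Qvar C l \<omega>) [1..<Suc n], Mvar \<omega>))"
proof -
  let ?Y = "\<lambda>\<omega>. (map (\<lambda>l. Avar C l \<omega>) [1..<Suc n], map (\<lambda>l. Qvar C l \<omega>) [1..<Suc n], Mvar \<omega>)"
  let ?YP = "\<lambda>\<omega>. (map (\<lambda>l. Avar P l \<omega>) [1..<Suc n], map (\<lambda>l. Qvar P l \<omega>) [1..<Suc n], Mvar \<omega>)"
  \<comment> \<open>Answers are kept, each query is tagged with \<open>j\<close>, and the index
    becomes a file number. The last component alone determines \<open>j\<close> and the index; with
    \<open>j\<close> known, the tags can be stripped.\<close>
  define h where "h = (\<lambda>(j :: nat, as :: 'a list list, qs :: 'q list, i :: nat).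
    (as, map (\<lambda>q. (q, j)) qs, inv_into {1..M} pos (j, i)))"
  have Y: "simple_function (ir_space N \<beta> C) ?Y"
    by (intro simple_function_Pair simple_function_map simple_function_Avar simple_function_Qvar_C
        simple_function_Mvar) auto
  have YP: "simple_function (ir_space M \<beta> P) ?YP"
    by (intro simple_function_Pair simple_function_map simple_function_Avar simple_function_Qvar_P
        simple_function_Mvar) auto
  have YP_eq: "?YP \<omega> = h (part \<omega>, ?Y (proj \<omega>))" if "\<omega> \<in> space (ir_space M \<beta> P)" for \<omega>
    using Mvar_P[OF that] by (simp add: h_def Avar_P Qvar_P)
  have h: "j = j' \<and> ?Y \<omega> = ?Y \<omega>'"
    if "h (j, ?Y \<omega>) = h (j', ?Y \<omega>')" "j \<in> {1..\<eta>}" "j' \<in> {1..\<eta>}"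
      "\<omega> \<in> space (ir_space N \<beta> C)" "\<omega>' \<in> space (ir_space N \<beta> C)" for j j' \<omega> \<omega>'
  proof -
    have "(j, Mvar \<omega>) = (j', Mvar \<omega>')"
      using that Mvar_mem by (intro inj_onD[OF inj_on_inv_pos]) (auto simp: h_def)
    moreover have "inj (\<lambda>q. (q, j))" by (simp add: inj_on_def)
    ultimately show ?thesis
      using that(1) by (auto simp: h_def dest: map_injective)
  qed
  have "H2 (ir_space M \<beta> P) ?YP = H2 (ir_space N \<beta> C) ?Y + log 2 \<eta>"
  proof (rule H2_partition[OF Y YP _ YP_eq])
    show "inj_on h ({1..\<eta>} \<times> ?Y ` space (ir_space N \<beta> C))"
      using h unfolding inj_on_def by blast
  qed
  moreover have "H2 (ir_space M \<beta> P) (\<lambda>\<omega>. (requested_file \<omega>, ?YP \<omega>)) =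
      H2 (ir_space N \<beta> C) (\<lambda>\<omega>. (requested_file \<omega>, ?Y \<omega>)) + log 2 \<eta>"
  proof (rule H2_partition[OF simple_function_Pair[OF simple_function_requested_file Y]
        simple_function_Pair[OF simple_function_requested_file YP], where h = "\<lambda>(j, x, y). (x, h (j, y))"])
    show "inj_on (\<lambda>(j, x, y). (x, h (j, y)))
        ({1..\<eta>} \<times> (\<lambda>\<omega>. (requested_file \<omega>, ?Y \<omega>)) ` space (ir_space N \<beta> C))"
      using h unfolding inj_on_def by fast
  qed (use YP_eq requested_file_P in simp)
  ultimately show ?thesis
    by (simp only: H2_cond_eq[OF prob_space_P simple_function_requested_file YP]
        H2_cond_eq[OF prob_space_C simple_function_requested_file Y])
qed

lemma is_ir_scheme_P: "is_ir_scheme M n \<beta> P"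
  unfolding is_ir_scheme_def
proof (intro conjI ballI)
  fix l assume l: "l \<in> {1..n}"
  fix q and X :: "nat \<Rightarrow> 'x list" assume q: "q \<in> queries P l" and X: "X \<in> file_space M \<beta>"
  obtain q' j where [simp]: "q = (q', j)" and q': "q' \<in> queries C l" and j: "j \<in> {1..\<eta>}"
    using q by (auto simp: queries_P)
  have "length (answer C l q' (partition_files M \<eta> pos j X)) = ans_len C l q'"
    using scheme l q' partition_files_mem[OF X j] by (simp add: is_ir_scheme_def)
  then show "length (answer P l q X) = ans_len P l q"
    by (simp add: partition_scheme_def)
next
  show "H2_cond (ir_space M \<beta> P) requested_file
     (\<lambda>\<omega>. (map (\<lambda>l. Avar P l \<omega>) [1..<Suc n], map (\<lambda>l. Qvar P l \<omega>) [1..<Suc n], Mvar \<omega>)) = 0"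
    unfolding retrieval_P using scheme by (simp only: is_ir_scheme_def)
qed (use prob_space_strategy measurable_query_P finite_queries in \<open>simp_all add: queries_P\<close>)

section \<open>The four leakage metrics\<close>

lemma leak_MI_P:
  assumes "1 \<le> n"
  shows "leak_MI M n \<beta> P = leak_MI N n \<beta> C + log 2 \<eta>"
proof -
  have "I2 (ir_space M \<beta> P) Mvar (Qvar P l) = I2 (ir_space N \<beta> C) Mvar (Qvar C l) + log 2 \<eta>"
    if l: "l \<in> {1..n}" for l
    using I2_eq[OF prob_space_P simple_function_Mvar simple_function_Qvar_P[OF l]]
      I2_eq[OF prob_space_C simple_function_Mvar simple_function_Qvar_C[OF l]]
      H2_Mvar H2_Qvar[OF l] H2_Mvar_Qvar[OF l]
    by linarith
  then have "(\<Sum>l\<in>{1..n}. I2 (ir_space M \<beta> P) Mvar (Qvar P l)) =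
      (\<Sum>l\<in>{1..n}. I2 (ir_space N \<beta> C) Mvar (Qvar C l) + log 2 \<eta>)"
    by (intro sum.cong refl)
  then show ?thesis
    using assms by (simp add: leak_MI_def sum.distrib field_simps)
qed

text \<open>Given the request, the partition number in the query is deterministic; only the other
  component is random.\<close>

lemma query_prob_P:
  assumes l: "l \<in> {1..n}" and m: "m \<in> {1..M}"
  shows "query_prob M \<beta> P l (q, j) m =
    (if fst (pos m) = j then query_prob N \<beta> C l q (snd (pos m)) else 0)"
proof -
  have i: "snd (pos m) \<in> {1..N}" using pos_mem[OF m] by simp
  have "query_prob M \<beta> P l (q, j) m =
      measure (strategy C) {s \<in> space (strategy C). query C l (snd (pos m)) s = q \<and> fst (pos m) = j}"
    using query_prob_eq[OF _ m measurable_query_P[OF l m], of \<beta> "(q, j)"] prob_space_strategy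
    by (simp add: query_P)
  then show ?thesis
    using query_prob_eq[OF prob_space_strategy i measurable_query[OF l i]] by simp
qed

text \<open>Requests inside partition \<open>j\<close> realise every index of \<open>C\<close>;
  requests outside contribute only zeros, which cannot exceed a maximum of probabilities.\<close>

lemma Max_query_prob_P:
  assumes l: "l \<in> {1..n}" and j: "j \<in> {1..\<eta>}"
  shows "(MAX m\<in>{1..M}. query_prob M \<beta> P l (q, j) m) = (MAX i\<in>{1..N}. query_prob N \<beta> C l q i)"
    (is "?L = ?R")
proof (rule antisym)
  have nonneg: "0 \<le> query_prob N \<beta> C l q i" if "i \<in> {1..N}" for i
    using query_prob_eq[OF prob_space_strategy that measurable_query[OF l that]] by simp
  have R: "query_prob N \<beta> C l q i \<le> ?R" if "i \<in> {1..N}" for i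
    using that by (intro Max_ge) auto
  have "0 \<le> ?R" using order_trans[OF nonneg R] N_pos by (meson atLeastAtMost_iff order_refl)
  then have "query_prob M \<beta> P l (q, j) m \<le> ?R" if "m \<in> {1..M}" for m
    using R pos_mem[OF that] by (simp only: query_prob_P[OF l that] split: if_split) blast
  then show "?L \<le> ?R" using M_pos by (intro Max.boundedI) auto
  have "query_prob N \<beta> C l q i \<le> ?L" if i: "i \<in> {1..N}" for i
  proof -
    have "(j, i) \<in> pos ` {1..M}" using bij_betw_imp_surj_on[OF bij_pos] i j by simp
    then obtain m where m: "m \<in> {1..M}" "pos m = (j, i)" by (metis imageE)
    have "query_prob M \<beta> P l (q, j) m \<le> ?L" using m(1) by (intro Max_ge) auto
    then show ?thesis using query_prob_P[OF l m(1), of q j] m(2) by simp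
  qed
  then show "?R \<le> ?L" using N_pos by (intro Max.boundedI) auto
qed

text \<open>Index 1 alone bounds the sum below by 1, since its query probabilities add up to 1.
  Positivity is what lets the logarithm of a product split.\<close>

lemma sum_Max_query_prob_pos:
  assumes l: "l \<in> {1..n}"
  shows "0 < (\<Sum>q\<in>queries C l. MAX i\<in>{1..N}. query_prob N \<beta> C l q i)"
proof -
  have 1: "1 \<in> {1..N}" using N_pos by simp
  note meas = measurable_query[OF l 1]
  have sub: "query C l 1 ` space (strategy C) \<subseteq> queries C l"
    using measurable_space[OF meas] by auto
  have "simple_function (strategy C) (query C l 1)"
    unfolding simple_function_eq_measurable
    using finite_subset[OF sub finite_queries[OF l]] measurable_compose[OF meas, of "\<lambda>q. q" "count_space UNIV"]
    by simp
  then have "1 = (\<Sum>q\<in>queries C l. query_prob N \<beta> C l q 1)"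
    using prob_simple_function_sum[OF prob_space_strategy _ sub finite_queries[OF l]]
      query_prob_eq[OF prob_space_strategy 1 meas] by simp
  also have "\<dots> \<le> (\<Sum>q\<in>queries C l. MAX i\<in>{1..N}. query_prob N \<beta> C l q i)"
    using 1 by (intro sum_mono Max_ge) auto
  finally show ?thesis by linarith
qed

text \<open>Each query \<open>q\<close> has the \<eta> copies \<open>(q, j)\<close> with the same
  maximal probability, so the sum inside the logarithm is multiplied by \<eta>.\<close>

lemma leak_MaxL_P:
  assumes n: "1 \<le> n"
  shows "leak_MaxL M n \<beta> P = leak_MaxL N n \<beta> C + log 2 \<eta>"
proof -
  let ?s = "\<lambda>l. \<Sum>q\<in>queries C l. MAX i\<in>{1..N}. query_prob N \<beta> C l q i"
  have "log 2 (\<Sum>q\<in>queries P l. MAX m\<in>{1..M}. query_prob M \<beta> P l q m) = log 2 (?s l) + log 2 \<eta>"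
    if l: "l \<in> {1..n}" for l
  proof -
    have "(\<Sum>q\<in>queries P l. MAX m\<in>{1..M}. query_prob M \<beta> P l q m) =
        (\<Sum>q\<in>queries C l. \<Sum>j\<in>{1..\<eta>}. MAX m\<in>{1..M}. query_prob M \<beta> P l (q, j) m)"
      unfolding queries_P sum.cartesian_product by (simp add: case_prod_unfold)
    also have "\<dots> = (\<Sum>q\<in>queries C l. \<Sum>j\<in>{1..\<eta>}. MAX i\<in>{1..N}. query_prob N \<beta> C l q i)"
      by (intro sum.cong refl Max_query_prob_P l)
    also have "\<dots> = ?s l * \<eta>"
      by (simp add: sum_distrib_left mult.commute)
    finally show ?thesis
      using sum_Max_query_prob_pos[OF l] \<eta>_pos by (simp add: log_mult)
  qed
  then have "leak_MaxL M n \<beta> P = (MAX l\<in>{1..n}. log 2 (?s l) + log 2 \<eta>)"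
    unfolding leak_MaxL_def by (intro arg_cong[where f = Max] image_cong refl)
  then show ?thesis
    using n by (simp add: leak_MaxL_def Max_add_commute)
qed

lemma sets_Qvar_C:
  assumes "l \<in> {1..n}"
  shows "{\<omega> \<in> space (ir_space N \<beta> C). Qvar C l \<omega> = q} \<in> sets (ir_space N \<beta> C)"
  using simple_functionD(2)[OF simple_function_Qvar_C[OF assms], of "{q}"]
  by (simp add: vimage_def Int_def conj_commute)

lemma Qvar_P_event:
  "{\<omega> \<in> space (ir_space M \<beta> P). Qvar P l \<omega> = (q, j)} = {\<omega> \<in> space (ir_space M \<beta> P).
     part \<omega> = j \<and> proj \<omega> \<in> {\<omega> \<in> space (ir_space N \<beta> C). Qvar C l \<omega> = q}}"
  using proj_mem by (auto simp: Qvar_P)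

lemma prob_Qvar_P:
  assumes "l \<in> {1..n}" "j \<in> {1..\<eta>}"
  shows "\<P>(\<omega> in ir_space M \<beta> P. Qvar P l \<omega> = (q, j)) = \<P>(\<omega> in ir_space N \<beta> C. Qvar C l \<omega> = q) / \<eta>"
  unfolding Qvar_P_event by (rule measure_partition_event[OF assms(2) sets_Qvar_C[OF assms(1)]])

text \<open>The query \<open>(q, j)\<close> places the request in partition \<open>j\<close>. There
  the joint probability and the query probability both shrink by the factor
  \<open>1 / \<eta>\<close>, so their ratio is the posterior in \<open>C\<close>; other requests
  have posterior 0 and add nothing.\<close>

lemma H2_event_P:
  assumes l: "l \<in> {1..n}" and j: "j \<in> {1..\<eta>}"
    and q: "0 < \<P>(\<omega> in ir_space N \<beta> C. Qvar C l \<omega> = q)"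
  shows "H2_event (ir_space M \<beta> P) Mvar (Qvar P l) (q, j) = H2_event (ir_space N \<beta> C) Mvar (Qvar C l) q"
proof -
  let ?E = "\<lambda>i. {\<omega> \<in> space (ir_space N \<beta> C). Mvar \<omega> = i \<and> Qvar C l \<omega> = q}"
  let ?c = "\<P>(\<omega> in ir_space N \<beta> C. Qvar C l \<omega> = q)"
  let ?f = "\<lambda>i. measure (ir_space N \<beta> C) (?E i) / ?c * log 2 (measure (ir_space N \<beta> C) (?E i) / ?c)"
  let ?g = "\<lambda>m. \<P>(\<omega> in ir_space M \<beta> P. Mvar \<omega> = m \<and> Qvar P l \<omega> = (q, j)) /
    \<P>(\<omega> in ir_space M \<beta> P. Qvar P l \<omega> = (q, j))"
  have E: "?E i \<in> sets (ir_space N \<beta> C)" for i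
    using sets.Int[OF sets_Qvar_C[OF l, of q] simple_functionD(2)[OF simple_function_Mvar[of N \<beta> C], of "{i}"]]
    by (simp add: vimage_def Int_def conj_ac cong: conj_cong)
  have g: "?g m = (if fst (pos m) = j then measure (ir_space N \<beta> C) (?E (snd (pos m))) / ?c else 0)"
    if m: "m \<in> {1..M}" for m
  proof (cases "fst (pos m) = j")
    case True
    have "Mvar \<omega> = m \<longleftrightarrow> Mvar (proj \<omega>) = snd (pos m)" if \<omega>: "\<omega> \<in> space (ir_space M \<beta> P)" "part \<omega> = j" for \<omega>
    proof -
      have "Mvar \<omega> \<in> {1..M}" using \<omega> by (auto simp: space_ir_space Mvar_def)
      then have "Mvar \<omega> = m \<longleftrightarrow> pos (Mvar \<omega>) = pos m"
        using inj_on_eq_iff[OF bij_betw_imp_inj_on[OF bij_pos]] m by blast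
      moreover have "pos (Mvar \<omega>) = (part \<omega>, Mvar (proj \<omega>))"
        by (simp add: Mvar_def part_def proj_def case_prod_unfold)
      ultimately show ?thesis using True \<omega>(2) by (simp add: prod_eq_iff)
    qed
    then have "{\<omega> \<in> space (ir_space M \<beta> P). Mvar \<omega> = m \<and> Qvar P l \<omega> = (q, j)} =
        {\<omega> \<in> space (ir_space M \<beta> P). part \<omega> = j \<and> proj \<omega> \<in> ?E (snd (pos m))}"
      using proj_mem by (auto simp: Qvar_P)
    then show ?thesis
      using True \<eta>_pos measure_partition_event[OF j E[of "snd (pos m)"]] prob_Qvar_P[OF l j, of q]
      by (simp only: if_True) simp
  next
    case False
    then have "{\<omega> \<in> space (ir_space M \<beta> P). Mvar \<omega> = m \<and> Qvar P l \<omega> = (q, j)} = {}"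
      by (auto simp: Qvar_P Mvar_def part_def)
    then show ?thesis using False by (simp only: if_False measure_empty div_0)
  qed
  have "H2_event (ir_space M \<beta> P) Mvar (Qvar P l) (q, j) = - (\<Sum>m\<in>{1..M}. ?g m * log 2 (?g m))"
  proof (rule H2_event_eq[OF prob_space_P simple_function_Mvar])
    show "Mvar ` space (ir_space M \<beta> P) \<subseteq> {1..M}" by (auto simp: space_ir_space Mvar_def)
    show "{\<omega> \<in> space (ir_space M \<beta> P). Qvar P l \<omega> = (q, j)} \<in> sets (ir_space M \<beta> P)"
      unfolding Qvar_P_event by (rule sets_partition_event[OF j sets_Qvar_C[OF l]])
    show "0 < \<P>(\<omega> in ir_space M \<beta> P. Qvar P l \<omega> = (q, j))"
      unfolding prob_Qvar_P[OF l j] using q \<eta>_pos by simp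
  qed simp
  also have "(\<Sum>m\<in>{1..M}. ?g m * log 2 (?g m)) =
      (\<Sum>m\<in>{1..M}. (\<lambda>(j', i). if j' = j then ?f i else 0) (pos m))"
  proof (intro sum.cong refl)
    fix m assume "m \<in> {1..M}"
    then show "?g m * log 2 (?g m) = (\<lambda>(j', i). if j' = j then ?f i else 0) (pos m)"
      by (simp only: g) (simp add: case_prod_unfold)
  qed
  also have "\<dots> = (\<Sum>(j', i)\<in>{1..\<eta>} \<times> {1..N}. if j' = j then ?f i else 0)"
    by (rule sum.reindex_bij_betw[OF bij_pos])
  also have "\<dots> = (\<Sum>j'\<in>{1..\<eta>}. if j' = j then (\<Sum>i\<in>{1..N}. ?f i) else 0)"
    unfolding sum.cartesian_product[symmetric] by (intro sum.cong refl) simp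
  also have "\<dots> = (\<Sum>i\<in>{1..N}. ?f i)"
    using j by simp
  also have "- \<dots> = H2_event (ir_space N \<beta> C) Mvar (Qvar C l) q"
    by (rule H2_event_eq[OF prob_space_C simple_function_Mvar _ _ sets_Qvar_C[OF l] q, symmetric])
      (auto dest: Mvar_mem)
  finally show ?thesis .
qed

text \<open>The possible queries are the possible queries of \<open>C\<close> with arbitrary tags,
  and tags do not affect the conditional entropies, so the minimum runs over the same values. The
  increase comes from \<open>H2_Mvar\<close> alone.\<close>

lemma leak_WIL_P:
  assumes n: "1 \<le> n"
  shows "leak_WIL M n \<beta> P = leak_WIL N n \<beta> C + log 2 \<eta>"
proof -
  let ?S = "\<lambda>l. {q \<in> queries C l. \<P>(\<omega> in ir_space N \<beta> C. Qvar C l \<omega> = q) > 0}"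
  let ?v = "\<lambda>l. H2 (ir_space N \<beta> C) Mvar - (MIN q\<in>?S l. H2_event (ir_space N \<beta> C) Mvar (Qvar C l) q)"
  have "H2 (ir_space M \<beta> P) Mvar -
      (MIN q\<in>{q \<in> queries P l. \<P>(\<omega> in ir_space M \<beta> P. Qvar P l \<omega> = q) > 0}.
        H2_event (ir_space M \<beta> P) Mvar (Qvar P l) q) = ?v l + log 2 \<eta>"
    if l: "l \<in> {1..n}" for l
  proof -
    have "{q \<in> queries P l. \<P>(\<omega> in ir_space M \<beta> P. Qvar P l \<omega> = q) > 0} = ?S l \<times> {1..\<eta>}"
      using prob_Qvar_P[OF l] \<eta>_pos by (auto simp: queries_P zero_less_divide_iff)
    moreover have "H2_event (ir_space M \<beta> P) Mvar (Qvar P l) ` (?S l \<times> {1..\<eta>}) =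
        H2_event (ir_space N \<beta> C) Mvar (Qvar C l) ` ?S l"
    proof -
      have "H2_event (ir_space M \<beta> P) Mvar (Qvar P l) ` (?S l \<times> {1..\<eta>}) =
        (\<lambda>x. H2_event (ir_space N \<beta> C) Mvar (Qvar C l) (fst x)) ` (?S l \<times> {1..\<eta>})"
        using H2_event_P[OF l] by (intro image_cong refl) auto
      also have "\<dots> = H2_event (ir_space N \<beta> C) Mvar (Qvar C l) ` fst ` (?S l \<times> {1..\<eta>})"
        by (simp only: image_image)
      also have "fst ` (?S l \<times> {1..\<eta>}) = ?S l"
        using \<eta>_pos by (simp add: fst_image_times)
      finally show ?thesis .
    qed
    ultimately show ?thesis
      unfolding H2_Mvar by (simp only: diff_add_eq)
  qed
  then have "leak_WIL M n \<beta> P = (MAX l\<in>{1..n}. ?v l + log 2 \<eta>)"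
    unfolding leak_WIL_def by (intro arg_cong[where f = Max] image_cong refl)
  then show ?thesis
    using n by (simp add: leak_WIL_def Max_add_commute)
qed

text \<open>A single partition merely renumbers the files and tags every query with 1; no zero
  probabilities arise, beyond those of \<open>C\<close>, and the maxima range over the same
  ratios.\<close>

lemma leak_EpsP_P:
  assumes \<eta>: "\<eta> = 1"
  shows "leak_EpsP M n \<beta> P = leak_EpsP N n \<beta> C"
proof -
  have img: "(\<lambda>m. g (snd (pos m))) ` {1..M} = g ` {1..N}" for g :: "nat \<Rightarrow> ereal"
  proof -
    have "(\<lambda>m. g (snd (pos m))) ` {1..M} = g ` snd ` pos ` {1..M}" by (simp add: image_image)
    also have "snd ` pos ` {1..M} = {1..N}"
      using bij_betw_imp_surj_on[OF bij_pos] \<eta> by simp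
    finally show ?thesis .
  qed
  let ?r = "\<lambda>l q m m'. ereal (query_prob M \<beta> P l q m) / ereal (query_prob M \<beta> P l q m')"
  let ?r' = "\<lambda>l q i i'. ereal (query_prob N \<beta> C l q i) / ereal (query_prob N \<beta> C l q i')"
  have "(MAX q\<in>queries P l. MAX m\<in>{1..M}. MAX m'\<in>{1..M}. ?r l q m m') =
      (MAX q\<in>queries C l. MAX i\<in>{1..N}. MAX i'\<in>{1..N}. ?r' l q i i')" if l: "l \<in> {1..n}" for l
  proof -
    have qp: "query_prob M \<beta> P l (q, 1) m = query_prob N \<beta> C l q (snd (pos m))" if "m \<in> {1..M}" for q m
      using query_prob_P[OF l that, of q 1] pos_mem[OF that] \<eta> by simp
    have inner: "(MAX m\<in>{1..M}. MAX m'\<in>{1..M}. ?r l (q, 1) m m') =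
        (MAX i\<in>{1..N}. MAX i'\<in>{1..N}. ?r' l q i i')" for q
    proof -
      have "(MAX m\<in>{1..M}. MAX m'\<in>{1..M}. ?r l (q, 1) m m') =
          (MAX m\<in>{1..M}. MAX m'\<in>{1..M}. ?r' l q (snd (pos m)) (snd (pos m')))"
        by (intro arg_cong[where f = Max] image_cong refl) (simp only: qp)
      then show ?thesis
        by (simp only: img[of "\<lambda>i'. ?r' l q _ i'"] img[of "\<lambda>i. MAX i'\<in>{1..N}. ?r' l q i i'"])
    qed
    have "queries P l = (\<lambda>q. (q, 1)) ` queries C l"
      unfolding queries_P using \<eta> by auto
    then show ?thesis by (simp only: image_image inner)
  qed
  then show ?thesis
    unfolding leak_EpsP_def
    by (intro arg_cong[where f = Max] image_cong refl) (simp only:)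
qed

end

theorem theorem2:
  fixes C :: "('s, 'q, 'x::finite, 'a::finite) ir_scheme"
    and lk :: leak_metric and pos :: "nat \<Rightarrow> nat \<times> nat"
    and M n \<eta> \<beta> :: nat and R U \<Delta> :: real and \<rho> :: ereal
  assumes "1 \<le> n" and "1 \<le> M" and "1 \<le> \<eta>" and "\<eta> dvd M"
    and "achieves lk (M div \<eta>) n \<beta> C (R, U, \<Delta>, \<rho>)"
    and "equal_partition M \<eta> pos"
    and eps: "lk = EpsP \<Longrightarrow> \<eta> = 1 \<or> \<rho> = \<infinity>"
  shows "achieves lk M n \<beta> (partition_scheme M \<eta> pos C)
           (R, U + real n * log 2 (real \<eta>), \<Delta>, \<rho> + ereal (log 2 (real \<eta>)))"
proof -
  interpret partitioned_scheme C pos M n \<eta> \<beta> "M div \<eta>"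
    by standard (use assms in \<open>auto simp: achieves_def\<close>)
  have "leakage lk M n \<beta> P = leakage lk (M div \<eta>) n \<beta> C + ereal (log 2 (real \<eta>))"
  proof (cases lk)
    \<comment> \<open>The metric uses \<open>ln\<close> and the increment \<open>log 2\<close>, but
      no change of base enters: the increment is 0 for one partition, and otherwise both leakages
      are infinite and absorb it.\<close>
    case EpsP
    show ?thesis
    proof (cases "\<eta> = 1")
      case True
      then show ?thesis using EpsP leak_EpsP_P by simp
    next
      case False
      then have "leak_EpsP M n \<beta> P = \<infinity>"
        using assms scheme by (intro leak_EpsP_partition_scheme) auto
      moreover have "leakage lk (M div \<eta>) n \<beta> C = \<infinity>"
        using eps EpsP False assms(5) by (simp add: achieves_def)
      ultimately show ?thesis using EpsP by simp
    qed
  qed (use assms(1) leak_MI_P leak_WIL_P leak_MaxL_P in simp_all)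
  then show ?thesis
    using assms(5) is_ir_scheme_P by (simp add: achieves_def rate_P upload_cost_P access_complexity_P)
qed

end
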